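(* Let $\mu>0$ and $t\in(0,\bar t^\mu)$, where $\bar t^\mu=\mu\sqrt2$. For $\xi,\zeta\in\mathscr{X}_1$ let $$G_t^\mu(\xi,\zeta)=\sup_{w\in \mathscr{W}_1[0,t]}\left\{\left.\int_0^t V(x_s)-T^\mu(w_s)\,ds\ \right|\ x_0=\xi,\ x_t=\zeta\right\},$$ where $x_s=\xi+\int_0^s w_\sigma\,d\sigma$ for $s\in[0,t]$. Then there are self-adjoint operators $\mathcal{P}_t^\mu,\mathcal{Q}_t^\mu\in\mathcal{L}(\mathscr{X}_1)$ such that $$G_t^\mu(\xi,\zeta)=\tfrac12\left\langle\begin{pmatrix}\xi\\ \zeta\end{pmatrix},\begin{pmatrix}\mathcal{P}_t^\mu&\mathcal{Q}_t^\mu\\ \mathcal{Q}_t^\mu&\mathcal{P}_t^\mu\end{pmatrix}\begin{pmatrix}\xi\\ \zeta\end{pmatrix}\right\rangle_\sharp\qquad\text{for all }\xi,\zeta\in\mathscr{X}_1.$$ Moreover, these operators are given by $$\mathcal{P}_t^\mu\,\xi=\sum_{n=1}^\infty [p_t^\mu]_n\langle\xi,\tilde\varphi_n\rangle_1\tilde\varphi_n,\qquad \mathcal{Q}_t^\mu\,\xi=\sum_{n=1}^\infty [q_t^\mu]_n\langle\xi,\tilde\varphi_n\rangle_1\tilde\varphi_n,\qquad \xi\in\mathscr{X}_1,$$ with eigenvalues $$[p_t^\mu]_n=\frac{-1}{\omega_n^\mu\tan(\omega_n^\mu t)},\qquad [q_t^\mu]_n=\frac{1}{\omega_n^\mu\sin(\omega_n^\mu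 t)},\qquad n\in\mathbb{N}.$$
   Context: $\mathscr{X}$ is a real $L_2$-space with inner product $\langle\cdot,\cdot\rangle$ and norm $\|\cdot\|$. $\Lambda$ is a linear, unbounded, positive, self-adjoint operator with domain $\mathscr{X}_2=\mathrm{dom}(\Lambda)$ dense in $\mathscr{X}$ and compact inverse $\Lambda^{-1}\in\mathcal{L}(\mathscr{X})$. $\Lambda^{1/2}$ is its unique positive self-adjoint square root, and $\mathscr{X}_1=\mathrm{dom}(\Lambda^{1/2})$ is a Hilbert space with $\langle x,\xi\rangle_1=\langle\Lambda^{1/2}x,\Lambda^{1/2}\xi\rangle$ and norm $\|\cdot\|_1$. $\{\varphi_n\}_{n\in\mathbb{N}}$ is an orthonormal basis of $\mathscr{X}$ of eigenvectors of $\Lambda$, $\Lambda\varphi_n=\lambda_n\varphi_n$, with $0<\lambda_1\le\lambda_2\le\cdots\to\infty$ (repeated according to multiplicity), and $\tilde\varphi_n=\varphi_n/\sqrt{\lambda_n}$, an orthonormal basis of $\mathscr{X}_1$. $\mathcal{L}(\mathscr{U};\mathscr{V})$ denotes the bounded linear operators from $\mathscr{U}$ to $\mathscr{V}$, and $\mathcal{L}(\mathscr{U})=\mathcal{L}(\mathscr{U};\mathscr{U})$. For $\mu>0$: $\omega_n^\mu=\sqrt{\lambda_n/(1+\mu^2\lambda_n)}$. $V(x)=\tfrac12\|x\|_1^2$ and $T^\mu(w)=\tfrac12\|w\|^2+\tfrac{\mu^2}{2}\|w\|_1^2$ for $x,w\in\mathscr{X}_1$. $\mathscr{W}_1[0,t]=L_2([0,t];\mathscr{X}_1)$.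 On $\mathscr{X}_1\times\mathscr{X}_1$, $\langle(x,z),(\xi,\zeta)\rangle_\sharp=\langle x,\xi\rangle_1+\langle z,\zeta\rangle_1$. *)

theory Defs
  imports "HOL-Analysis.Analysis"
begin

section \<open>Unbounded operators on a real Hilbert space\<close>

text \<open>An operator is given by its domain \<open>D\<close> and a function \<open>A\<close>; the values of \<open>A\<close> outside \<open>D\<close>
  are irrelevant.\<close>

definition linear_operator_on :: "'a::real_vector set \<Rightarrow> ('a \<Rightarrow> 'a) \<Rightarrow> bool" where
  "linear_operator_on D A \<longleftrightarrow> subspace D \<and>
     (\<forall>x\<in>D. \<forall>y\<in>D. A (x + y) = A x + A y) \<and> (\<forall>c. \<forall>x\<in>D. A (c *\<^sub>R x) = c *\<^sub>R A x)"

definition op_graph :: "'a set \<Rightarrow> ('a \<Rightarrow> 'a) \<Rightarrow> ('a \<times> 'a) set" where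
  "op_graph D A = {(x, A x) | x. x \<in> D}"

definition adjoint_graph :: "'a::real_inner set \<Rightarrow> ('a \<Rightarrow> 'a) \<Rightarrow> ('a \<times> 'a) set" where
  "adjoint_graph D A = {(y, z). \<forall>x\<in>D. inner (A x) y = inner x z}"

definition self_adjoint_on :: "'a::real_inner set \<Rightarrow> ('a \<Rightarrow> 'a) \<Rightarrow> bool" where
  "self_adjoint_on D A \<longleftrightarrow>
     linear_operator_on D A \<and> closure D = UNIV \<and> adjoint_graph D A = op_graph D A"

definition positive_on :: "'a::real_inner set \<Rightarrow> ('a \<Rightarrow> 'a) \<Rightarrow> bool" where
  "positive_on D A \<longleftrightarrow> (\<forall>x\<in>D. x \<noteq> 0 \<longrightarrow> 0 < inner (A x) x)"

definition unbounded_on :: "'a::real_normed_vector set \<Rightarrow> ('a \<Rightarrow> 'a) \<Rightarrow> bool" where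
  "unbounded_on D A \<longleftrightarrow> \<not> (\<exists>K. \<forall>x\<in>D. norm (A x) \<le> K * norm x)"

definition compact_operator :: "('a::real_normed_vector \<Rightarrow> 'a) \<Rightarrow> bool" where
  "compact_operator R \<longleftrightarrow> bounded_linear R \<and> compact (closure (R ` cball 0 1))"

definition has_compact_inverse_on :: "'a::real_normed_vector set \<Rightarrow> ('a \<Rightarrow> 'a) \<Rightarrow> bool" where
  "has_compact_inverse_on D A \<longleftrightarrow> bij_betw A D UNIV \<and> compact_operator (inv_into D A)"

text \<open>The first conjunct says that \<open>D\<close> is the natural domain of the composition of \<open>S\<close> with
  itself.\<close>

definition positive_square_root_on ::
    "'a::real_inner set \<Rightarrow> ('a \<Rightarrow> 'a) \<Rightarrow> 'a set \<Rightarrow> ('a \<Rightarrow> 'a) \<Rightarrow> bool" where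
  "positive_square_root_on D A D1 S \<longleftrightarrow>
     self_adjoint_on D1 S \<and> positive_on D1 S \<and>
     D = {x \<in> D1. S x \<in> D1} \<and> (\<forall>x\<in>D. S (S x) = A x)"

definition orthonormal_basis :: "(nat \<Rightarrow> 'a::real_inner) \<Rightarrow> bool" where
  "orthonormal_basis \<phi> \<longleftrightarrow>
     (\<forall>m n. inner (\<phi> m) (\<phi> n) = (if m = n then 1 else 0)) \<and> closure (span (range \<phi>)) = UNIV"

section \<open>The space \<open>dom S\<close> with the inner product of \<open>S\<close>\<close>

text \<open>The Hilbert space \<open>D1\<close> with inner product \<open>inner (S x) (S y)\<close> is represented by a type \<open>'b\<close>
  of its own, so that the library's topology, series, Bochner integral and bounded operators on
  \<open>'b\<close> are those of this Hilbert space; \<open>\<iota>\<close> is the inclusion of \<open>D1\<close> into the ambient space \<open>'a\<close>.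
  If \<open>S\<close> is a bijection from \<open>D1\<close> onto \<open>'a\<close>, as it is for the square root of an operator with
  bounded inverse, then \<open>'b = 'a\<close> with \<open>\<iota> = S\<^sup>-\<^sup>1\<close> is always such a representation.\<close>

definition represents_domain ::
    "('b::real_inner \<Rightarrow> 'a::real_inner) \<Rightarrow> 'a set \<Rightarrow> ('a \<Rightarrow> 'a) \<Rightarrow> bool" where
  "represents_domain \<iota> D1 S \<longleftrightarrow>
     linear \<iota> \<and> range \<iota> = D1 \<and> (\<forall>x y. inner x y = inner (S (\<iota> x)) (S (\<iota> y)))"

section \<open>The optimal control problem\<close>

definition omega :: "real \<Rightarrow> real \<Rightarrow> real" where
  "omega \<mu> l = sqrt (l / (1 + \<mu>\<^sup>2 * l))"

definition tbar :: "real \<Rightarrow> real" where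
  "tbar \<mu> = \<mu> * sqrt 2"

definition potential :: "'b::real_inner \<Rightarrow> real" where
  "potential x = (norm x)\<^sup>2 / 2"

definition kinetic :: "('b::real_inner \<Rightarrow> 'a::real_inner) \<Rightarrow> real \<Rightarrow> 'b \<Rightarrow> real" where
  "kinetic \<iota> \<mu> w = (norm (\<iota> w))\<^sup>2 / 2 + \<mu>\<^sup>2 / 2 * (norm w)\<^sup>2"

text \<open>Borel representatives of the elements of \<open>L\<^sub>2([0,t])\<close> with values in \<open>'b\<close>.\<close>

definition square_integrable_inputs ::
    "real \<Rightarrow> (real \<Rightarrow> 'b::{real_inner, banach, second_countable_topology}) set" where
  "square_integrable_inputs t =
     {w. set_borel_measurable lborel {0..t} w \<and> set_integrable lborel {0..t} (\<lambda>s. (norm (w s))\<^sup>2)}"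

definition trajectory ::
    "'b::{real_inner, banach, second_countable_topology} \<Rightarrow> (real \<Rightarrow> 'b) \<Rightarrow> real \<Rightarrow> 'b" where
  "trajectory \<xi> w s = \<xi> + (LBINT \<sigma>:{0..s}. w \<sigma>)"

text \<open>The supremum is taken in the extended reals, so that its finiteness is not presupposed.\<close>

definition G_value ::
    "('b::{real_inner, banach, second_countable_topology} \<Rightarrow> 'a::real_inner) \<Rightarrow>
     real \<Rightarrow> real \<Rightarrow> 'b \<Rightarrow> 'b \<Rightarrow> ereal" where
  "G_value \<iota> \<mu> t \<xi> \<zeta> =
     (SUP w \<in> {w \<in> square_integrable_inputs t. trajectory \<xi> w 0 = \<xi> \<and> trajectory \<xi> w t = \<zeta>}.
        ereal (LBINT s:{0..t}. potential (trajectory \<xi> w s) - kinetic \<iota> \<mu> (w s)))"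

text \<open>The block operator with rows \<open>(P, Q)\<close> and \<open>(Q, P)\<close>. The library's inner product on
  \<open>'b \<times> 'b\<close> is the sum of the componentwise inner products.\<close>

definition block_operator ::
    "('b::real_normed_vector \<Rightarrow>\<^sub>L 'b) \<Rightarrow> ('b \<Rightarrow>\<^sub>L 'b) \<Rightarrow> 'b \<times> 'b \<Rightarrow> 'b \<times> 'b" where
  "block_operator P Q = (\<lambda>(\<xi>, \<zeta>). (P \<xi> + Q \<zeta>, Q \<xi> + P \<zeta>))"

definition p_eigenvalue :: "real \<Rightarrow> real \<Rightarrow> real \<Rightarrow> real" where
  "p_eigenvalue \<mu> t l = - 1 / (omega \<mu> l * tan (omega \<mu> l * t))"

definition q_eigenvalue :: "real \<Rightarrow> real \<Rightarrow> real \<Rightarrow> real" where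
  "q_eigenvalue \<mu> t l = 1 / (omega \<mu> l * sin (omega \<mu> l * t))"

end

theory Submission
  imports Defs
begin

text \<open>
  Expanded in the orthonormal basis \<open>\<phi>t\<close> of the Hilbert space \<open>'b\<close>, the problem is diagonal. Since
  \<open>\<parallel>\<iota> w\<parallel>\<^sup>2\<close> is the sum of \<open>(w\<^sub>n)\<^sup>2 / \<lambda>\<^sub>n\<close> over the coordinates \<open>w\<^sub>n = \<langle>w, \<phi>t n\<rangle>\<close>, and
  \<open>1 / \<lambda>\<^sub>n + \<mu>\<^sup>2 = 1 / \<omega>\<^sub>n\<^sup>2\<close>, the cost of an input \<open>w\<close> is the sum over the modes of the scalar costs
  \<open>1/2 \<integral> (x\<^sub>n)\<^sup>2 - (w\<^sub>n)\<^sup>2 / \<omega>\<^sub>n\<^sup>2\<close> (\<open>kinetic_sums\<close>, \<open>cost_sums_mode_costs\<close>).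

  In one mode the stationary path with end points \<open>a\<close> and \<open>b\<close> solves \<open>x'' = - \<omega>\<^sup>2 x\<close>, and its cost is
  an explicit quadratic form of \<open>(a, b)\<close>, whose coefficients are the claimed eigenvalues
  (\<open>extremal_cost\<close>). Any other path with the same ends differs from it by some \<open>y\<close> that vanishes at
  both ends. The cross term drops out after integration by parts, and the rest is
  \<open>\<integral> y\<^sup>2 - (y')\<^sup>2 / \<omega>\<^sup>2\<close>, which is not positive when \<open>(\<omega> t)\<^sup>2 \<le> 2\<close>: by the Cauchy-Schwarz inequality
  \<open>y(s)\<^sup>2 \<le> s \<integral> (y')\<^sup>2\<close>, and integration over \<open>s\<close> gives the factor \<open>t\<^sup>2 / 2\<close>. As \<open>\<omega>\<^sub>n < 1 / \<mu>\<close>, the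
  condition \<open>t < \<mu> sqrt 2\<close> covers all modes at once (\<open>short_time_cost_nonpos\<close>, \<open>mode_cost_le\<close>).

  Summing the mode inequalities bounds the supremum from above. From below it is approached by
  inputs that are extremal in the modes below some \<open>N\<close> and have constant velocity in the others, so
  that they are finite sums of continuous functions and still join the prescribed ends; the cost
  in the modes from \<open>N\<close> on is bounded below by minus a constant times the tail of
  \<open>\<parallel>\<xi>\<parallel>\<^sup>2 + \<parallel>\<zeta>\<parallel>\<^sup>2\<close>, which vanishes in the limit (\<open>G_value_eq_sum_of_mode_values\<close>).

  Finally \<open>\<omega>\<^sub>n \<rightarrow> 1 / \<mu>\<close>, so the eigenvalues are bounded, and the diagonal operators that they define
  are bounded and self-adjoint (\<open>eigenvalues_bounded\<close>, \<open>diagonal_operator_exists\<close>).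
\<close>

section \<open>Total orthonormal systems and diagonal operators\<close>

text \<open>Totality is expressed by the triviality of the orthogonal complement: in a complete space it is
  equivalent to density of the span, and it is directly the principle that a vector is determined by
  its coordinates.\<close>

definition total_orthonormal :: "(nat \<Rightarrow> 'b::real_inner) \<Rightarrow> bool" where
  "total_orthonormal e \<longleftrightarrow>
     (\<forall>m n. inner (e m) (e n) = (if m = n then 1 else 0)) \<and>
     (\<forall>x. (\<forall>n. inner x (e n) = 0) \<longrightarrow> x = 0)"

lemma total_orthonormal_inner:
  "total_orthonormal e \<Longrightarrow> inner (e m) (e n) = (if m = n then 1 else 0)"
  by (simp add: total_orthonormal_def)

lemma total_orthonormal_eqI:
  assumes "total_orthonormal e" and "\<And>n. inner x (e n) = inner y (e n)"
  shows "x = y"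
proof -
  have "x - y = 0"
    using assms unfolding total_orthonormal_def by (metis inner_diff_left diff_self)
  then show ?thesis by simp
qed

lemma orthonormal_basis_imp_total:
  fixes \<phi> :: "nat \<Rightarrow> 'a::real_inner"
  assumes "orthonormal_basis \<phi>"
  shows "total_orthonormal \<phi>"
proof -
  have "x = 0" if x: "\<And>n. inner x (\<phi> n) = 0" for x
  proof -
    have "span (range \<phi>) \<subseteq> {y. inner x y = 0}"
      by (rule span_minimal) (auto simp: x subspace_def inner_add_right)
    moreover have "closed {y. inner x y = 0}"
      by (intro closed_Collect_eq continuous_intros)
    ultimately have "closure (span (range \<phi>)) \<subseteq> {y. inner x y = 0}"
      by (rule closure_minimal)
    then have "x \<in> {y. inner x y = 0}"
      using assms by (auto simp only: orthonormal_basis_def)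
    then show ?thesis by simp
  qed
  then show ?thesis
    using assms by (auto simp: total_orthonormal_def orthonormal_basis_def)
qed

lemma inner_sum_orthonormal:
  assumes "total_orthonormal e" and "finite F"
  shows "inner (\<Sum>m\<in>F. c m *\<^sub>R e m) (e n) = (if n \<in> F then c n else 0)"
  using assms by (simp add: inner_sum_left total_orthonormal_inner if_distrib cong: if_cong)

lemma norm_sum_orthonormal:
  assumes "total_orthonormal e" and "finite F"
  shows "(norm (\<Sum>m\<in>F. c m *\<^sub>R e m))\<^sup>2 = (\<Sum>m\<in>F. (c m)\<^sup>2)"
  using assms
  by (simp add: power2_norm_eq_inner inner_sum_right inner_sum_orthonormal power2_eq_square[of "c _"]
      cong: sum.cong)

lemma bessel_inequality:
  assumes "total_orthonormal e" and "finite F"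
  shows "(\<Sum>n\<in>F. (inner x (e n))\<^sup>2) \<le> (norm x)\<^sup>2"
proof -
  let ?p = "\<Sum>n\<in>F. inner x (e n) *\<^sub>R e n"
  have "inner x ?p = (\<Sum>n\<in>F. (inner x (e n))\<^sup>2)"
    by (simp add: inner_sum_right power2_eq_square)
  then have "(norm (x - ?p))\<^sup>2 = (norm x)\<^sup>2 - (\<Sum>n\<in>F. (inner x (e n))\<^sup>2)"
    using norm_sum_orthonormal[OF assms, of "\<lambda>n. inner x (e n)"]
    by (simp add: power2_norm_eq_inner inner_diff_left inner_diff_right inner_commute)
  then show ?thesis
    using zero_le_power2[of "norm (x - ?p)"] by linarith
qed

lemma summable_coefficients_squared:
  assumes "total_orthonormal e"
  shows "summable (\<lambda>n. (inner x (e n))\<^sup>2)"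
  by (rule summableI_nonneg_bounded[where x = "(norm x)\<^sup>2"])
     (auto intro!: bessel_inequality assms)

text \<open>By Pythagoras the squared norm of a block of the series is a block of \<open>\<Sum> (c n)\<^sup>2\<close>, so the Cauchy
  criterion carries over.\<close>

lemma summable_orthonormal_series:
  fixes e :: "nat \<Rightarrow> 'b::{real_inner, banach}"
  assumes "total_orthonormal e" and "summable (\<lambda>n. (c n)\<^sup>2)"
  shows "summable (\<lambda>n. c n *\<^sub>R e n)"
  unfolding summable_Cauchy
proof (intro allI impI)
  fix r :: real
  assume "0 < r"
  then have "0 < r\<^sup>2" by simp
  with assms(2) obtain N where N: "\<And>m n. N \<le> m \<Longrightarrow> norm (\<Sum>k\<in>{m..<n}. (c k)\<^sup>2) < r\<^sup>2"
    unfolding summable_Cauchy by metis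
  have "norm (\<Sum>k\<in>{m..<n}. c k *\<^sub>R e k) < r" if "N \<le> m" for m n
  proof -
    have "(norm (\<Sum>k\<in>{m..<n}. c k *\<^sub>R e k))\<^sup>2 < r\<^sup>2"
      using N[OF that, of n] norm_sum_orthonormal[OF assms(1), of "{m..<n}" c] by simp
    then show ?thesis
      using \<open>0 < r\<close> power_less_imp_less_base by (metis less_imp_le)
  qed
  then show "\<exists>N. \<forall>m\<ge>N. \<forall>n. norm (\<Sum>k = m..<n. c k *\<^sub>R e k) < r" by blast
qed

lemma inner_orthonormal_series:
  assumes "total_orthonormal e" and "(\<lambda>n. c n *\<^sub>R e n) sums x"
  shows "inner x (e n) = c n"
proof -
  have "(\<lambda>m. inner (c m *\<^sub>R e m) (e n)) sums inner x (e n)"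
    by (rule bounded_linear.sums[OF bounded_linear_inner_left assms(2)])
  moreover have "(\<lambda>m. inner (c m *\<^sub>R e m) (e n)) = (\<lambda>m. if m = n then c m else 0)"
    using assms(1) by (auto simp: total_orthonormal_inner)
  ultimately show ?thesis
    using sums_single[of n c] sums_unique2 by fastforce
qed

text \<open>The series converges, and its limit has the same coordinates as \<open>x\<close>.\<close>

lemma orthonormal_expansion:
  fixes e :: "nat \<Rightarrow> 'b::{real_inner, banach}"
  assumes "total_orthonormal e"
  shows "(\<lambda>n. inner x (e n) *\<^sub>R e n) sums x"
proof -
  obtain y where y: "(\<lambda>n. inner x (e n) *\<^sub>R e n) sums y"
    using summable_orthonormal_series[OF assms summable_coefficients_squared[OF assms]]
    by (auto simp: summable_def)
  then have "y = x"
    by (intro total_orthonormal_eqI[OF assms] inner_orthonormal_series[OF assms])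
  with y show ?thesis by simp
qed

lemma parseval_identity:
  fixes e :: "nat \<Rightarrow> 'b::{real_inner, banach}"
  assumes "total_orthonormal e"
  shows "(\<lambda>n. inner x (e n) * inner y (e n)) sums inner x y"
  using bounded_linear.sums[OF bounded_linear_inner_left orthonormal_expansion[OF assms, of x], of y]
  by (simp add: inner_commute)

lemma parseval_norm:
  fixes e :: "nat \<Rightarrow> 'b::{real_inner, banach}"
  assumes "total_orthonormal e"
  shows "(\<lambda>n. (inner x (e n))\<^sup>2) sums (norm x)\<^sup>2"
  using parseval_identity[OF assms, of x x]
  by (simp only: power2_norm_eq_inner power2_eq_square[of "inner _ _"])

lemma self_adjoint_on_UNIVI:
  fixes f :: "'b::real_inner \<Rightarrow> 'b"
  assumes "linear f" and "\<And>x y. inner (f x) y = inner x (f y)"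
  shows "self_adjoint_on UNIV f"
proof -
  have "z = f y" if "\<And>x. inner (f x) y = inner x z" for y z
  proof -
    have "inner (z - f y) (z - f y) = 0"
      using that[of "z - f y"] assms(2)[of "z - f y" y] by (simp add: inner_diff_right)
    then show ?thesis by simp
  qed
  then have "adjoint_graph UNIV f = op_graph UNIV f"
    using assms(2) by (auto simp: adjoint_graph_def op_graph_def)
  then show ?thesis
    using assms(1) by (simp add: self_adjoint_on_def linear_operator_on_def linear_add linear_cmul)
qed

text \<open>The third property, the diagonal form of the associated bilinear form, follows from Parseval's
  identity; symmetry of the operator is then visible in it, and so is the bound on the norm.\<close>

lemma diagonal_operator_exists:
  fixes e :: "nat \<Rightarrow> 'b::{real_inner, banach}"
  assumes e: "total_orthonormal e" and d: "\<And>n. \<bar>d n\<bar> \<le> K"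
  obtains P :: "'b \<Rightarrow>\<^sub>L 'b" where
    "self_adjoint_on UNIV (blinfun_apply P)"
    "\<And>x. (\<lambda>n. (d n * inner x (e n)) *\<^sub>R e n) sums P x"
    "\<And>x y. (\<lambda>n. d n * (inner x (e n) * inner y (e n))) sums inner x (P y)"
proof -
  define f where "f x = (\<Sum>n. (d n * inner x (e n)) *\<^sub>R e n)" for x
  have dsq: "(d n)\<^sup>2 \<le> K\<^sup>2" for n
    using d[of n] by (metis abs_ge_zero power2_abs power_mono)
  have sums: "(\<lambda>n. (d n * inner x (e n)) *\<^sub>R e n) sums f x" for x
    unfolding f_def
  proof (rule summable_sums, rule summable_orthonormal_series[OF e], rule summable_comparison_test')
    show "summable (\<lambda>n. K\<^sup>2 * (inner x (e n))\<^sup>2)"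
      by (intro summable_mult summable_coefficients_squared e)
    show "norm ((d n * inner x (e n))\<^sup>2) \<le> K\<^sup>2 * (inner x (e n))\<^sup>2" for n
      using dsq[of n] by (simp add: power_mult_distrib mult_right_mono)
  qed
  have coeff: "inner (f x) (e n) = d n * inner x (e n)" for x n
    by (rule inner_orthonormal_series[OF e sums])
  have form: "(\<lambda>n. d n * (inner x (e n) * inner y (e n))) sums inner x (f y)" for x y
    using parseval_identity[OF e, of x "f y"] by (simp add: coeff mult_ac)
  have sym: "inner (f x) y = inner x (f y)" for x y
    using form[of x y] form[of y x] by (simp add: inner_commute mult.commute sums_unique2)
  have lin: "linear f"
    by (rule linearI; rule total_orthonormal_eqI[OF e])
       (simp_all add: coeff inner_add_left algebra_simps)
  have bound: "norm (f x) \<le> norm x * \<bar>K\<bar>" for x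
  proof -
    have "(\<lambda>n. (inner (f x) (e n))\<^sup>2) sums (norm (f x))\<^sup>2"
      by (rule parseval_norm[OF e])
    moreover have "(\<lambda>n. K\<^sup>2 * (inner x (e n))\<^sup>2) sums (K\<^sup>2 * (norm x)\<^sup>2)"
      by (rule sums_mult[OF parseval_norm[OF e]])
    moreover have "(inner (f x) (e n))\<^sup>2 \<le> K\<^sup>2 * (inner x (e n))\<^sup>2" for n
      using dsq[of n] by (simp add: coeff power_mult_distrib mult_right_mono)
    ultimately have "(norm (f x))\<^sup>2 \<le> K\<^sup>2 * (norm x)\<^sup>2"
      by (rule sums_le[rotated])
    then have "(norm (f x))\<^sup>2 \<le> (norm x * \<bar>K\<bar>)\<^sup>2"
      by (simp add: power_mult_distrib mult.commute)
    then show ?thesis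
      by (rule power2_le_imp_le) simp
  qed
  have bl: "bounded_linear f"
    using lin bound by (auto intro!: bounded_linear_intro[where K = "\<bar>K\<bar>"] simp: linear_add linear_cmul)
  have app: "blinfun_apply (Blinfun f) = f"
    by (rule bounded_linear_Blinfun_apply[OF bl])
  show ?thesis
    by (rule that[of "Blinfun f"]) (simp_all add: app sums form self_adjoint_on_UNIVI lin sym)
qed

section \<open>The eigenbasis in the domain of the square root\<close>

text \<open>An eigenvector of \<open>\<Lambda>\<close> lies in the domain of \<open>S\<^sup>2\<close>, so one factor \<open>S\<close> can be moved across the inner
  product.\<close>

lemma square_root_of_eigenvector:
  assumes sqrt: "positive_square_root_on D \<Lambda> D1 S"
    and \<phi>: "\<phi> \<in> D" "\<Lambda> \<phi> = l *\<^sub>R \<phi>" and x: "x \<in> D1"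
  shows "inner (S x) (S \<phi>) = l * inner x \<phi>"
proof -
  have D1: "\<phi> \<in> D1" "S \<phi> \<in> D1" "S (S \<phi>) = \<Lambda> \<phi>"
    using sqrt \<phi>(1) by (auto simp: positive_square_root_on_def)
  have "(S \<phi>, S (S \<phi>)) \<in> adjoint_graph D1 S"
    using sqrt D1 by (auto simp: positive_square_root_on_def self_adjoint_on_def op_graph_def)
  then show ?thesis
    using x D1(3) \<phi>(2) by (simp add: adjoint_graph_def)
qed

text \<open>The dictionary between the two Hilbert spaces: a coordinate in \<open>'b\<close> is the ambient coordinate
  scaled by \<open>sqrt l\<close>.\<close>

lemma square_root_domain_coefficient:
  assumes sqrt: "positive_square_root_on D \<Lambda> D1 S" and dom: "represents_domain \<iota> D1 S"
    and \<phi>: "\<phi> \<in> D" "\<Lambda> \<phi> = l *\<^sub>R \<phi>" and l: "0 < l"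
    and \<psi>: "\<iota> \<psi> = \<phi> /\<^sub>R sqrt l"
  shows "inner x \<psi> = sqrt l * inner (\<iota> x) \<phi>"
proof -
  have D1: "\<phi> \<in> D1" "\<iota> x \<in> D1"
    using sqrt dom \<phi>(1) by (auto simp: positive_square_root_on_def represents_domain_def)
  have "S (c *\<^sub>R \<phi>) = c *\<^sub>R S \<phi>" for c
    using sqrt D1
    by (simp add: positive_square_root_on_def self_adjoint_on_def linear_operator_on_def)
  then have "inner x \<psi> = inverse (sqrt l) * inner (S (\<iota> x)) (S \<phi>)"
    using dom \<psi> by (simp add: represents_domain_def)
  also have "\<dots> = inverse (sqrt l) * (l * inner (\<iota> x) \<phi>)"
    by (simp add: square_root_of_eigenvector[OF sqrt \<phi> D1(2)])
  also have "\<dots> = sqrt l * inner (\<iota> x) \<phi>"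
    using l by (simp add: field_simps)
  finally show ?thesis .
qed

lemma normalized_eigenvectors_total:
  assumes sqrt: "positive_square_root_on D \<Lambda> D1 S" and dom: "represents_domain \<iota> D1 S"
    and basis: "total_orthonormal \<phi>"
    and \<phi>: "\<And>n. \<phi> n \<in> D" "\<And>n. \<Lambda> (\<phi> n) = eig n *\<^sub>R \<phi> n" and eig: "\<And>n. 0 < eig n"
    and \<phi>t: "\<And>n. \<iota> (\<phi>t n) = \<phi> n /\<^sub>R sqrt (eig n)"
  shows "total_orthonormal \<phi>t"
proof -
  note coeff = square_root_domain_coefficient[OF sqrt dom \<phi> eig \<phi>t]
  have "inner (\<phi>t m) (\<phi>t n) = (if m = n then 1 else 0)" for m n
    using basis eig[of n] by (simp add: coeff \<phi>t total_orthonormal_inner)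
  moreover have "x = 0" if x: "\<And>n. inner x (\<phi>t n) = 0" for x
  proof -
    have "inner (\<iota> x) (\<phi> n) = 0" for n
      using x[of n] eig[of n] by (simp add: coeff)
    then have "\<iota> x = 0"
      using basis by (simp add: total_orthonormal_def)
    moreover have "\<iota> 0 = 0"
      using dom by (simp add: represents_domain_def linear_0)
    ultimately have "inner x x = inner 0 (0::'a)"
      using dom unfolding represents_domain_def by (metis inner_zero_left inner_zero_right)
    then show ?thesis by simp
  qed
  ultimately show ?thesis
    by (auto simp: total_orthonormal_def)
qed

lemma omega_pos: "0 < l \<Longrightarrow> 0 < omega \<mu> l"
  by (simp add: omega_def add_pos_nonneg)

lemma inverse_omega_squared:
  assumes "0 < l"
  shows "1 / (omega \<mu> l)\<^sup>2 = 1 / l + \<mu>\<^sup>2"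
proof -
  have "0 < 1 + \<mu>\<^sup>2 * l"
    using assms by (simp add: add_pos_nonneg)
  then show ?thesis
    using assms by (simp add: omega_def field_simps)
qed

text \<open>Parseval's identity in the ambient space gives the part with weights \<open>1 / \<lambda>\<^sub>n\<close>, Parseval's identity
  in \<open>'b\<close> the part with weight \<open>\<mu>\<^sup>2\<close>.\<close>

lemma kinetic_sums:
  fixes w :: "'b::{real_inner, banach}" and \<phi> :: "nat \<Rightarrow> 'a::{real_inner, banach}"
  assumes sqrt: "positive_square_root_on D \<Lambda> D1 S" and dom: "represents_domain \<iota> D1 S"
    and basis: "total_orthonormal \<phi>"
    and \<phi>: "\<And>n. \<phi> n \<in> D" "\<And>n. \<Lambda> (\<phi> n) = eig n *\<^sub>R \<phi> n" and eig: "\<And>n. 0 < eig n"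
    and \<phi>t: "\<And>n. \<iota> (\<phi>t n) = \<phi> n /\<^sub>R sqrt (eig n)"
  shows "(\<lambda>n. (inner w (\<phi>t n))\<^sup>2 / (omega \<mu> (eig n))\<^sup>2 / 2) sums kinetic \<iota> \<mu> w"
proof -
  note coeff = square_root_domain_coefficient[OF sqrt dom \<phi> eig \<phi>t]
  have "(inner (\<iota> w) (\<phi> n))\<^sup>2 = (inner w (\<phi>t n))\<^sup>2 / eig n" for n
    using eig[of n] by (simp add: coeff power_mult_distrib)
  then have 1: "(\<lambda>n. (inner w (\<phi>t n))\<^sup>2 / eig n) sums (norm (\<iota> w))\<^sup>2"
    using parseval_norm[OF basis, of "\<iota> w"] by simp
  have 2: "(\<lambda>n. (inner w (\<phi>t n))\<^sup>2) sums (norm w)\<^sup>2"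
    by (rule parseval_norm[OF normalized_eigenvectors_total[OF assms]])
  have "(\<lambda>n. (inner w (\<phi>t n))\<^sup>2 / eig n / 2 + \<mu>\<^sup>2 / 2 * (inner w (\<phi>t n))\<^sup>2) sums
      ((norm (\<iota> w))\<^sup>2 / 2 + \<mu>\<^sup>2 / 2 * (norm w)\<^sup>2)"
    by (intro sums_add sums_mult sums_divide 1 2)
  moreover have "(inner w (\<phi>t n))\<^sup>2 / (omega \<mu> (eig n))\<^sup>2 / 2 =
      (inner w (\<phi>t n))\<^sup>2 / eig n / 2 + \<mu>\<^sup>2 / 2 * (inner w (\<phi>t n))\<^sup>2" for n
  proof -
    have "(inner w (\<phi>t n))\<^sup>2 / (omega \<mu> (eig n))\<^sup>2 / 2 =
        (inner w (\<phi>t n))\<^sup>2 * (1 / (omega \<mu> (eig n))\<^sup>2) / 2" by simp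
    then show ?thesis
      unfolding inverse_omega_squared[OF eig] by (simp add: algebra_simps)
  qed
  ultimately show ?thesis
    by (simp add: kinetic_def)
qed

section \<open>Primitives of integrable functions\<close>

lemma set_integral_FTC:
  fixes F f :: "real \<Rightarrow> real"
  assumes "a \<le> b" and "\<And>x. (F has_real_derivative f x) (at x)" and "\<And>x. isCont f x"
  shows "(LBINT x:{a..b}. f x) = F b - F a"
  using integral_FTC_Icc_real[OF assms(1), of F f] assms(2,3)
  by (simp add: set_lebesgue_integral_def mult.commute)

lemma set_integral_const_interval:
  fixes c s :: real
  assumes "0 \<le> s"
  shows "(LBINT \<sigma>:{0..s}. c) = s * c"
proof -
  have "(LBINT \<sigma>:{0..s}. c) = s * c - 0 * c"
    by (rule set_integral_FTC[OF assms]) (auto intro!: derivative_eq_intros)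
  then show ?thesis by simp
qed

lemma set_integral_singleton:
  fixes w :: "real \<Rightarrow> 'b::{real_inner, banach, second_countable_topology}"
  shows "(LBINT \<sigma>:{s..s}. w \<sigma>) = 0"
proof -
  have "AE \<sigma> in lborel. indicator {s..s} \<sigma> *\<^sub>R w \<sigma> = 0"
    using AE_lborel_singleton[of s] by eventually_elim simp
  then show ?thesis
    unfolding set_lebesgue_integral_def by (rule integral_eq_zero_AE)
qed

lemma set_integrable_of_square:
  fixes w :: "real \<Rightarrow> 'b::{real_inner, banach, second_countable_topology}"
  assumes "set_borel_measurable lborel {a..b} w" and "set_integrable lborel {a..b} (\<lambda>s. (norm (w s))\<^sup>2)"
  shows "set_integrable lborel {a..b} w"
proof (rule set_integrable_bound[OF _ assms(1)])
  show "set_integrable lborel {a..b} (\<lambda>s. 1 + (norm (w s))\<^sup>2)"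
    by (intro set_integral_add(1) assms(2) borel_integrable_atLeastAtMost' continuous_intros)
  have "norm (w s) \<le> 1 + (norm (w s))\<^sup>2" for s
    using zero_le_power2[of "norm (w s) - 1"] norm_ge_zero[of "w s"]
    unfolding power2_diff by (simp, linarith)
  then show "AE x in lborel. x \<in> {a..b} \<longrightarrow> norm (w x) \<le> norm (1 + (norm (w x))\<^sup>2)"
    by (auto intro!: order_trans[OF _ abs_ge_self])
qed

text \<open>The Cauchy-Schwarz inequality against the constant function, obtained from
  \<open>0 \<le> \<integral> (s v - I)\<^sup>2\<close> with \<open>I = \<integral> v\<close>.\<close>

lemma integral_squared_le:
  fixes v :: "real \<Rightarrow> real"
  assumes "0 \<le> s" and v: "set_integrable lborel {0..s} v"
    and v2: "set_integrable lborel {0..s} (\<lambda>\<sigma>. (v \<sigma>)\<^sup>2)"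
  shows "(LBINT \<sigma>:{0..s}. v \<sigma>)\<^sup>2 \<le> s * (LBINT \<sigma>:{0..s}. (v \<sigma>)\<^sup>2)"
proof -
  define I where "I = (LBINT \<sigma>:{0..s}. v \<sigma>)"
  have constI: "set_integrable lborel {0..s} (\<lambda>_. c)" for c :: real
    by (intro borel_integrable_atLeastAtMost' continuous_intros)
  have v2s: "set_integrable lborel {0..s} (\<lambda>\<sigma>. s\<^sup>2 * (v \<sigma>)\<^sup>2)"
    and vI: "set_integrable lborel {0..s} (\<lambda>\<sigma>. 2 * s * I * v \<sigma>)"
    using v2 v by auto
  have "0 \<le> (LBINT \<sigma>:{0..s}. (s * v \<sigma> - I)\<^sup>2)"
    unfolding set_lebesgue_integral_def by (intro integral_nonneg_AE) auto
  also have "(\<lambda>\<sigma>. (s * v \<sigma> - I)\<^sup>2) = (\<lambda>\<sigma>. s\<^sup>2 * (v \<sigma>)\<^sup>2 - 2 * s * I * v \<sigma> + I\<^sup>2)"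
    by (auto simp: power2_eq_square algebra_simps)
  also have "(LBINT \<sigma>:{0..s}. s\<^sup>2 * (v \<sigma>)\<^sup>2 - 2 * s * I * v \<sigma> + I\<^sup>2) =
      s\<^sup>2 * (LBINT \<sigma>:{0..s}. (v \<sigma>)\<^sup>2) - 2 * s * I * I + I\<^sup>2 * s"
    using v2s vI constI[of "I\<^sup>2"] by (simp add: set_integral_const_interval[OF assms(1)] I_def mult.commute)
  finally have "0 \<le> s * (s * (LBINT \<sigma>:{0..s}. (v \<sigma>)\<^sup>2) - I\<^sup>2)"
    by (simp add: power2_eq_square algebra_simps)
  then show ?thesis
    using assms(1) using set_integral_singleton[of 0 v]
    by (cases "s = 0") (auto simp: I_def zero_le_mult_iff)
qed

lemma primitive_borel_measurable:
  fixes w :: "real \<Rightarrow> 'b::{real_inner, banach, second_countable_topology}"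
  assumes "set_integrable lborel {0..t} w"
  shows "set_borel_measurable lborel {0..t} (\<lambda>s. LBINT \<sigma>:{0..s}. w \<sigma>)"
proof -
  define W where "W \<sigma> = indicator {0..t} \<sigma> *\<^sub>R w \<sigma>" for \<sigma>
  have [measurable]: "W \<in> borel_measurable borel"
    using assms by (auto simp: set_integrable_def W_def[abs_def] dest: borel_measurable_integrable)
  have "(\<lambda>s. indicator {0..t} s *\<^sub>R (\<integral>\<sigma>. (if \<sigma> \<le> s then W \<sigma> else 0) \<partial>lborel))
      \<in> borel_measurable lborel"
    by measurable
  also have "(\<lambda>s. indicator {0..t} s *\<^sub>R (\<integral>\<sigma>. (if \<sigma> \<le> s then W \<sigma> else 0) \<partial>lborel)) =
      (\<lambda>s. indicator {0..t} s *\<^sub>R (LBINT \<sigma>:{0..s}. w \<sigma>))"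
    unfolding set_lebesgue_integral_def W_def
    by (intro ext) (auto split: split_indicator intro!: Bochner_Integration.integral_cong)
  finally show ?thesis
    by (simp add: set_borel_measurable_def)
qed

lemma norm_primitive_le:
  fixes w :: "real \<Rightarrow> 'b::{real_inner, banach, second_countable_topology}"
  assumes w: "set_integrable lborel {0..t} w" and s: "s \<in> {0..t}"
  shows "norm (LBINT \<sigma>:{0..s}. w \<sigma>) \<le> (LBINT \<sigma>:{0..t}. norm (w \<sigma>))"
proof -
  have ws: "set_integrable lborel {0..s} w"
    using s by (intro set_integrable_subset[OF w]) auto
  have "norm (LBINT \<sigma>:{0..s}. w \<sigma>) \<le> (LBINT \<sigma>:{0..s}. norm (w \<sigma>))"
    by (rule set_integral_norm_bound[OF ws])
  also have "\<dots> \<le> (LBINT \<sigma>:{0..t}. norm (w \<sigma>))"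
    using set_integrable_norm[OF ws] set_integrable_norm[OF w] s
    unfolding set_lebesgue_integral_def set_integrable_def
    by (intro integral_mono) (auto split: split_indicator)
  finally show ?thesis .
qed

lemma primitive_mult_integrable:
  fixes v g :: "real \<Rightarrow> real"
  assumes v: "set_integrable lborel {0..t} v" and g: "set_integrable lborel {0..t} g"
  shows "set_integrable lborel {0..t} (\<lambda>s. g s * (LBINT \<sigma>:{0..s}. v \<sigma>))"
proof (rule set_integrable_bound)
  let ?K = "LBINT \<sigma>:{0..t}. norm (v \<sigma>)"
  show "set_integrable lborel {0..t} (\<lambda>s. ?K * g s)"
    using g by simp
  have [measurable]: "(\<lambda>s. indicator {0..t} s *\<^sub>R (LBINT \<sigma>:{0..s}. v \<sigma>)) \<in> borel_measurable borel"
    "(\<lambda>s. indicator {0..t} s *\<^sub>R g s) \<in> borel_measurable borel"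
    using primitive_borel_measurable[OF v] g
    by (auto simp: set_borel_measurable_def set_integrable_def dest: borel_measurable_integrable)
  have "(\<lambda>s. (indicator {0..t} s *\<^sub>R (LBINT \<sigma>:{0..s}. v \<sigma>)) * (indicator {0..t} s *\<^sub>R g s))
      \<in> borel_measurable lborel" by measurable
  also have "(\<lambda>s. (indicator {0..t} s *\<^sub>R (LBINT \<sigma>:{0..s}. v \<sigma>)) * (indicator {0..t} s *\<^sub>R g s)) =
      (\<lambda>s. indicator {0..t} s *\<^sub>R (g s * (LBINT \<sigma>:{0..s}. v \<sigma>)))"
    by (auto split: split_indicator)
  finally show "set_borel_measurable lborel {0..t} (\<lambda>s. g s * (LBINT \<sigma>:{0..s}. v \<sigma>))"
    by (simp add: set_borel_measurable_def)
  show "AE s in lborel. s \<in> {0..t} \<longrightarrow>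
      norm (g s * (LBINT \<sigma>:{0..s}. v \<sigma>)) \<le> norm (?K * g s)"
  proof (intro AE_I2 impI)
    fix s assume "s \<in> {0..t}"
    from norm_primitive_le[OF v this] have "\<bar>LBINT \<sigma>:{0..s}. v \<sigma>\<bar> \<le> \<bar>?K\<bar>" by simp
    then have "\<bar>LBINT \<sigma>:{0..s}. v \<sigma>\<bar> * \<bar>g s\<bar> \<le> \<bar>?K\<bar> * \<bar>g s\<bar>"
      by (rule mult_right_mono) simp
    then show "norm (g s * (LBINT \<sigma>:{0..s}. v \<sigma>)) \<le> norm (?K * g s)"
      by (simp add: abs_mult mult.commute)
  qed
qed

text \<open>Integration by parts where one factor is only a primitive of an integrable function. Both sides are
  the integral of \<open>g s * v \<sigma>\<close> over the triangle \<open>\<sigma> \<le> s\<close>, so Fubini's theorem applies.\<close>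

lemma integral_by_parts_primitive:
  fixes v g A :: "real \<Rightarrow> real"
  assumes v: "set_integrable lborel {0..t} v"
    and A: "\<And>x. (A has_real_derivative g x) (at x)" and g: "\<And>x. isCont g x"
  shows "(LBINT s:{0..t}. g s * (LBINT \<sigma>:{0..s}. v \<sigma>)) = (LBINT \<sigma>:{0..t}. (A t - A \<sigma>) * v \<sigma>)"
proof -
  define V where "V \<sigma> = indicator {0..t} \<sigma> *\<^sub>R v \<sigma>" for \<sigma>
  define H where "H s = indicator {0..t} s *\<^sub>R g s" for s
  have V: "integrable lborel V"
    using v by (simp add: V_def[abs_def] set_integrable_def)
  have "set_integrable lborel {0..t} g"
    by (intro borel_integrable_atLeastAtMost' continuous_at_imp_continuous_on ballI g)
  then have H: "integrable lborel H"
    by (simp add: H_def[abs_def] set_integrable_def)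
  have [measurable]: "V \<in> borel_measurable borel" "H \<in> borel_measurable borel"
    using V H by (auto dest: borel_measurable_integrable)
  have prod: "integrable (lborel \<Otimes>\<^sub>M lborel) (\<lambda>(s, \<sigma>). H s * V \<sigma>)"
  proof (rule lborel_pair.Fubini_integrable)
    show "integrable lborel (\<lambda>x. LBINT y. norm (case (x, y) of (s, \<sigma>) \<Rightarrow> H s * V \<sigma>))"
      using H by (simp add: abs_mult)
    show "AE x in lborel. integrable lborel (\<lambda>y. case (x, y) of (s, \<sigma>) \<Rightarrow> H s * V \<sigma>)"
      using V by simp
  qed measurable
  have tri: "integrable (lborel \<Otimes>\<^sub>M lborel) (\<lambda>(s, \<sigma>). indicator {p. snd p \<le> fst p} (s, \<sigma>) *\<^sub>R (H s * V \<sigma>))"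
  proof -
    have "{p \<in> space (borel \<Otimes>\<^sub>M borel). snd p \<le> fst p} \<in> sets (borel \<Otimes>\<^sub>M (borel :: real measure))"
      by measurable
    then have "{p. snd p \<le> fst p} \<in> sets (lborel \<Otimes>\<^sub>M (lborel :: real measure))"
      by (simp add: space_pair_measure cong: sets_pair_measure_cong)
    from integrable_mult_indicator[OF this prod] show ?thesis
      by (simp add: split_beta')
  qed
  have "(LBINT s:{0..t}. g s * (LBINT \<sigma>:{0..s}. v \<sigma>)) =
      (LBINT s. LBINT \<sigma>. indicator {p. snd p \<le> fst p} (s, \<sigma>) *\<^sub>R (H s * V \<sigma>))"
    unfolding set_lebesgue_integral_def
  proof (intro Bochner_Integration.integral_cong refl)
    fix s :: real
    have "(LBINT \<sigma>. indicator {p. snd p \<le> fst p} (s, \<sigma>) *\<^sub>R (H s * V \<sigma>)) =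
        (LBINT \<sigma>. H s * (indicator {0..s} \<sigma> *\<^sub>R v \<sigma>))"
      by (intro Bochner_Integration.integral_cong)
         (auto simp: H_def V_def split: split_indicator)
    then show "indicator {0..t} s *\<^sub>R (g s * (LBINT x. indicator {0..s} x *\<^sub>R v x)) =
        (LBINT \<sigma>. indicator {p. snd p \<le> fst p} (s, \<sigma>) *\<^sub>R (H s * V \<sigma>))"
      by (simp add: H_def)
  qed
  also have "\<dots> = (LBINT \<sigma>. LBINT s. indicator {p. snd p \<le> fst p} (s, \<sigma>) *\<^sub>R (H s * V \<sigma>))"
    using lborel_pair.Fubini_integral[OF tri] by simp
  also have "\<dots> = (LBINT \<sigma>:{0..t}. (A t - A \<sigma>) * v \<sigma>)"
    unfolding set_lebesgue_integral_def
  proof (intro Bochner_Integration.integral_cong refl)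
    fix \<sigma> :: real
    show "(LBINT s. indicator {p. snd p \<le> fst p} (s, \<sigma>) *\<^sub>R (H s * V \<sigma>)) =
        indicator {0..t} \<sigma> *\<^sub>R ((A t - A \<sigma>) * v \<sigma>)"
    proof (cases "\<sigma> \<in> {0..t}")
      case True
      have "(LBINT s. indicator {p. snd p \<le> fst p} (s, \<sigma>) *\<^sub>R (H s * V \<sigma>)) =
          (LBINT s. (indicator {\<sigma>..t} s *\<^sub>R g s) * v \<sigma>)"
        using True
        by (intro Bochner_Integration.integral_cong)
           (auto simp: H_def V_def split: split_indicator)
      also have "\<dots> = (LBINT s:{\<sigma>..t}. g s) * v \<sigma>"
        by (simp add: set_lebesgue_integral_def)
      finally show ?thesis
        using True set_integral_FTC[OF _ A g, of \<sigma> t] by simp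
    qed (simp add: V_def)
  qed
  finally show ?thesis .
qed

section \<open>The variational problem of a single mode\<close>

text \<open>The solution of \<open>x'' = - \<omega>\<^sup>2 x\<close> with \<open>x 0 = a\<close> and \<open>x t = b\<close>, which is unique when
  \<open>sin (\<omega> * t) \<noteq> 0\<close>.\<close>

definition extremal :: "real \<Rightarrow> real \<Rightarrow> real \<Rightarrow> real \<Rightarrow> real \<Rightarrow> real" where
  "extremal \<omega> t a b s = (a * sin (\<omega> * (t - s)) + b * sin (\<omega> * s)) / sin (\<omega> * t)"

definition extremal_velocity :: "real \<Rightarrow> real \<Rightarrow> real \<Rightarrow> real \<Rightarrow> real \<Rightarrow> real" where
  "extremal_velocity \<omega> t a b s =
     \<omega> * (b * cos (\<omega> * s) - a * cos (\<omega> * (t - s))) / sin (\<omega> * t)"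

text \<open>Twice the optimal cost of a single mode with end points \<open>a\<close> and \<open>b\<close>.\<close>

definition mode_value :: "real \<Rightarrow> real \<Rightarrow> real \<Rightarrow> real \<Rightarrow> real" where
  "mode_value \<omega> t a b =
     - 1 / (\<omega> * tan (\<omega> * t)) * (a\<^sup>2 + b\<^sup>2) + 2 * (1 / (\<omega> * sin (\<omega> * t))) * (a * b)"

lemma extremal_DERIV:
  "(extremal \<omega> t a b has_real_derivative extremal_velocity \<omega> t a b s) (at s)"
  unfolding extremal_def[abs_def] extremal_velocity_def
  by (rule DERIV_cdivide) (auto intro!: derivative_eq_intros simp: algebra_simps)

lemma extremal_velocity_DERIV:
  "(extremal_velocity \<omega> t a b has_real_derivative - \<omega>\<^sup>2 * extremal \<omega> t a b s) (at s)"
  unfolding extremal_def extremal_velocity_def[abs_def] times_divide_eq_right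
  by (rule DERIV_cdivide) (auto intro!: derivative_eq_intros simp: algebra_simps power2_eq_square)

lemma isCont_extremal [continuous_intros]: "isCont (extremal \<omega> t a b) s"
  by (rule DERIV_isCont[OF extremal_DERIV])

lemma isCont_extremal_velocity [continuous_intros]: "isCont (extremal_velocity \<omega> t a b) s"
  by (rule DERIV_isCont[OF extremal_velocity_DERIV])

lemma extremal_primitive:
  assumes "0 \<le> s" and "sin (\<omega> * t) \<noteq> 0"
  shows "a + (LBINT \<sigma>:{0..s}. extremal_velocity \<omega> t a b \<sigma>) = extremal \<omega> t a b s"
  using set_integral_FTC[OF assms(1) extremal_DERIV isCont_extremal_velocity] assms(2)
  by (simp add: extremal_def)

text \<open>Along a solution \<open>x\<close> of \<open>x'' = - \<omega>\<^sup>2 x\<close> the integrand is the derivative of \<open>- x x' / \<omega>\<^sup>2\<close>.\<close>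

lemma extremal_cost:
  assumes "0 \<le> t" and "0 < \<omega>" and sin: "sin (\<omega> * t) \<noteq> 0" 
  shows "(LBINT s:{0..t}. (extremal \<omega> t a b s)\<^sup>2 - (extremal_velocity \<omega> t a b s)\<^sup>2 / \<omega>\<^sup>2) =
    mode_value \<omega> t a b"
proof -
  let ?x = "extremal \<omega> t a b" and ?w = "extremal_velocity \<omega> t a b"
  have "((\<lambda>s. - (?x s * ?w s) / \<omega>\<^sup>2) has_real_derivative (?x s)\<^sup>2 - (?w s)\<^sup>2 / \<omega>\<^sup>2) (at s)" for s
    using assms(2)
    by (auto intro!: derivative_eq_intros extremal_DERIV extremal_velocity_DERIV
        simp: field_simps power2_eq_square)
  moreover have "isCont (\<lambda>s. (?x s)\<^sup>2 - (?w s)\<^sup>2 / \<omega>\<^sup>2) s" for s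
    using assms(2) by (intro continuous_intros) auto
  ultimately have "(LBINT s:{0..t}. (?x s)\<^sup>2 - (?w s)\<^sup>2 / \<omega>\<^sup>2) =
      - (?x t * ?w t) / \<omega>\<^sup>2 - - (?x 0 * ?w 0) / \<omega>\<^sup>2"
    by (rule set_integral_FTC[OF assms(1)])
  also have "\<dots> = - (b * ?w t) / \<omega>\<^sup>2 - - (a * ?w 0) / \<omega>\<^sup>2"
    using sin by (simp add: extremal_def)
  also have "\<dots> = mode_value \<omega> t a b"
    using assms(2) sin
    by (simp add: extremal_velocity_def mode_value_def tan_def field_simps power2_eq_square)
  finally show ?thesis .
qed

text \<open>The origin of the time bound: \<open>y(s)\<^sup>2 \<le> s \<integral> v\<^sup>2\<close> for the primitive \<open>y\<close> of \<open>v\<close>, and \<open>s\<close> integrates to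
  \<open>t\<^sup>2 / 2 \<le> 1 / \<omega>\<^sup>2\<close>.\<close>

lemma short_time_cost_nonpos:
  fixes v :: "real \<Rightarrow> real"
  assumes t: "0 \<le> t" and \<omega>: "0 < \<omega>" and short: "(\<omega> * t)\<^sup>2 \<le> 2"
    and v: "set_integrable lborel {0..t} v" and v2: "set_integrable lborel {0..t} (\<lambda>\<sigma>. (v \<sigma>)\<^sup>2)"
    and y2: "set_integrable lborel {0..t} (\<lambda>s. (LBINT \<sigma>:{0..s}. v \<sigma>)\<^sup>2)"
  shows "(LBINT s:{0..t}. (LBINT \<sigma>:{0..s}. v \<sigma>)\<^sup>2) \<le> (LBINT s:{0..t}. (v s)\<^sup>2) / \<omega>\<^sup>2"
proof -
  let ?E = "LBINT s:{0..t}. (v s)\<^sup>2"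
  have E: "0 \<le> ?E"
    unfolding set_lebesgue_integral_def by (intro integral_nonneg_AE) auto
  have pointwise: "(LBINT \<sigma>:{0..s}. v \<sigma>)\<^sup>2 \<le> ?E * s" if s: "s \<in> {0..t}" for s
  proof -
    have sub: "set_integrable lborel {0..s} v" "set_integrable lborel {0..s} (\<lambda>\<sigma>. (v \<sigma>)\<^sup>2)"
      using s by (auto intro: set_integrable_subset[OF v] set_integrable_subset[OF v2])
    have "(LBINT \<sigma>:{0..s}. (v \<sigma>)\<^sup>2) \<le> ?E"
      using sub(2) v2 s unfolding set_lebesgue_integral_def set_integrable_def
      by (intro integral_mono) (auto split: split_indicator)
    then have "s * (LBINT \<sigma>:{0..s}. (v \<sigma>)\<^sup>2) \<le> s * ?E"
      using s by (intro mult_left_mono) auto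
    then show ?thesis
      using integral_squared_le[OF _ sub] s by (simp add: mult.commute)
  qed
  have "(LBINT s:{0..t}. (LBINT \<sigma>:{0..s}. v \<sigma>)\<^sup>2) \<le> (LBINT s:{0..t}. ?E * s)"
    by (intro set_integral_mono y2 pointwise borel_integrable_atLeastAtMost' continuous_intros)
  also have "\<dots> = ?E * (t\<^sup>2 / 2)"
  proof -
    have "(LBINT s:{0..t}. s) = t\<^sup>2 / 2 - 0\<^sup>2 / 2"
      by (rule set_integral_FTC[OF t]) (auto intro!: derivative_eq_intros)
    then show ?thesis by simp
  qed
  also have "\<dots> \<le> ?E * (1 / \<omega>\<^sup>2)"
    using short \<omega> by (intro mult_left_mono E) (simp add: field_simps)
  finally show ?thesis by simp
qed

text \<open>The path is compared with the extremal one with the same ends. With \<open>y\<close> the difference of the paths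
  and \<open>v\<close> that of the velocities, the cost splits into the extremal cost, a cross term that vanishes
  because the extremal is stationary, and the cost of \<open>y\<close>, which is not positive.\<close>

lemma mode_cost_le:
  fixes w :: "real \<Rightarrow> real"
  assumes t: "0 \<le> t" and \<omega>: "0 < \<omega>" and sin: "sin (\<omega> * t) \<noteq> 0" and short: "(\<omega> * t)\<^sup>2 \<le> 2"
    and w: "set_integrable lborel {0..t} w" and w2: "set_integrable lborel {0..t} (\<lambda>s. (w s)\<^sup>2)"
    and ends: "a + (LBINT \<sigma>:{0..t}. w \<sigma>) = b"
  shows "(LBINT s:{0..t}. (a + (LBINT \<sigma>:{0..s}. w \<sigma>))\<^sup>2 - (w s)\<^sup>2 / \<omega>\<^sup>2) \<le> mode_value \<omega> t a b"
proof -
  let ?x = "extremal \<omega> t a b" and ?u = "extremal_velocity \<omega> t a b"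
  define v where "v s = w s - ?u s" for s
  define y where "y s = (LBINT \<sigma>:{0..s}. v \<sigma>)" for s
  have contx: "continuous_on A ?x" and contu: "continuous_on A ?u" for A
    by (intro continuous_at_imp_continuous_on ballI continuous_intros)+
  have u: "set_integrable lborel {0..s} ?u" for s
    by (intro borel_integrable_atLeastAtMost' contu)
  have x: "set_integrable lborel {0..s} ?x" for s
    by (intro borel_integrable_atLeastAtMost' contx)
  have v: "set_integrable lborel {0..t} v"
    unfolding v_def by (intro set_integral_diff w u)
  have split: "a + (LBINT \<sigma>:{0..s}. w \<sigma>) = ?x s + y s" if s: "s \<in> {0..t}" for s
  proof -
    have "set_integrable lborel {0..s} w"
      using s by (intro set_integrable_subset[OF w]) auto
    then have "y s = (LBINT \<sigma>:{0..s}. w \<sigma>) - (LBINT \<sigma>:{0..s}. ?u \<sigma>)"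
      unfolding y_def v_def by (intro set_integral_diff u)
    then show ?thesis
      using extremal_primitive[of s \<omega> t a b] s sin by simp
  qed
  have "y t = 0"
    using split[of t] t ends sin by (simp add: extremal_def)
  have wm: "set_borel_measurable lborel {0..t} w"
    using w by (auto simp: set_integrable_def set_borel_measurable_def)
  have uw: "set_integrable lborel {0..t} (\<lambda>s. ?u s * w s)"
  proof (rule set_integrable_bound)
    show "set_integrable lborel {0..t} (\<lambda>s. (?u s)\<^sup>2 + (w s)\<^sup>2)"
      by (intro set_integral_add(1) w2 borel_integrable_atLeastAtMost' continuous_intros contu)
    have [measurable]: "?u \<in> borel_measurable borel"
      by (intro borel_measurable_continuous_onI contu)
    have "(\<lambda>s. ?u s * (indicator {0..t} s *\<^sub>R w s)) \<in> borel_measurable lborel"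
      using wm by (simp add: set_borel_measurable_def)
    then show "set_borel_measurable lborel {0..t} (\<lambda>s. ?u s * w s)"
      by (simp add: set_borel_measurable_def mult.left_commute)
    have "\<bar>p * q\<bar> \<le> p\<^sup>2 + q\<^sup>2" for p q :: real
    proof -
      have "2 * \<bar>p * q\<bar> \<le> p\<^sup>2 + q\<^sup>2"
        using sum_squares_bound[of "\<bar>p\<bar>" "\<bar>q\<bar>"] by (simp add: abs_mult mult.assoc)
      then show ?thesis by linarith
    qed
    then show "AE s in lborel. s \<in> {0..t} \<longrightarrow> norm (?u s * w s) \<le> norm ((?u s)\<^sup>2 + (w s)\<^sup>2)"
      by (auto intro!: order_trans[OF _ abs_ge_self])
  qed
  have u2: "set_integrable lborel {0..t} (\<lambda>s. (?u s)\<^sup>2)"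
    by (intro borel_integrable_atLeastAtMost' continuous_intros contu)
  have x2: "set_integrable lborel {0..t} (\<lambda>s. (?x s)\<^sup>2)"
    by (intro borel_integrable_atLeastAtMost' continuous_intros contx)
  have uv: "set_integrable lborel {0..t} (\<lambda>s. ?u s * v s)"
    using set_integral_diff(1)[OF uw u2] by (simp add: v_def algebra_simps power2_eq_square)
  have v2: "set_integrable lborel {0..t} (\<lambda>s. (v s)\<^sup>2)"
  proof -
    have "(\<lambda>s. (v s)\<^sup>2) = (\<lambda>s. (w s)\<^sup>2 - 2 * (?u s * w s) + (?u s)\<^sup>2)"
      by (auto simp: v_def power2_eq_square algebra_simps)
    then show ?thesis
      using w2 uw u2 by simp
  qed
  have y: "set_integrable lborel {0..t} y"
    using primitive_mult_integrable[OF v, of "\<lambda>_. 1"] unfolding y_def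
    by (simp add: borel_integrable_atLeastAtMost')
  have xy: "set_integrable lborel {0..t} (\<lambda>s. ?x s * y s)"
    unfolding y_def by (rule primitive_mult_integrable[OF v x])
  have y2: "set_integrable lborel {0..t} (\<lambda>s. (y s)\<^sup>2)"
    using primitive_mult_integrable[OF v y] by (simp add: y_def power2_eq_square)
  \<comment> \<open>\<open>- ?u / \<omega>\<^sup>2\<close> is an antiderivative of \<open>?x\<close>, and the boundary term vanishes with \<open>y t\<close>.\<close>
  have cross: "(LBINT s:{0..t}. ?x s * y s) = (LBINT s:{0..t}. ?u s * v s) / \<omega>\<^sup>2"
  proof -
    have D: "((\<lambda>s. - ?u s / \<omega>\<^sup>2) has_real_derivative ?x s) (at s)" for s
      using DERIV_cdivide[OF DERIV_minus[OF extremal_velocity_DERIV[of \<omega> t a b s]], of "\<omega>\<^sup>2"] \<omega>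
      by simp
    have "(LBINT s:{0..t}. ?x s * y s) =
        (LBINT s:{0..t}. (- ?u t / \<omega>\<^sup>2 - - ?u s / \<omega>\<^sup>2) * v s)"
      unfolding y_def by (rule integral_by_parts_primitive[OF v D isCont_extremal])
    also have "\<dots> = (LBINT s:{0..t}. (?u s * v s) / \<omega>\<^sup>2 - (?u t / \<omega>\<^sup>2) * v s)"
      by (simp add: algebra_simps)
    also have "\<dots> = (LBINT s:{0..t}. ?u s * v s) / \<omega>\<^sup>2 - (?u t / \<omega>\<^sup>2) * y t"
      using uv v by (simp add: y_def)
    finally show ?thesis
      using \<open>y t = 0\<close> by simp
  qed
  have "(LBINT s:{0..t}. (a + (LBINT \<sigma>:{0..s}. w \<sigma>))\<^sup>2 - (w s)\<^sup>2 / \<omega>\<^sup>2) =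
      (LBINT s:{0..t}. ((?x s)\<^sup>2 - (?u s)\<^sup>2 / \<omega>\<^sup>2) +
        (2 * (?x s * y s) - 2 * ((?u s * v s) / \<omega>\<^sup>2)) + ((y s)\<^sup>2 - (v s)\<^sup>2 / \<omega>\<^sup>2))"
  proof (rule set_lebesgue_integral_cong, simp, intro allI impI)
    fix s assume s: "s \<in> {0..t}"
    have "w s = ?u s + v s" by (simp add: v_def)
    then show "(a + (LBINT \<sigma>:{0..s}. w \<sigma>))\<^sup>2 - (w s)\<^sup>2 / \<omega>\<^sup>2 =
        ((?x s)\<^sup>2 - (?u s)\<^sup>2 / \<omega>\<^sup>2) +
        (2 * (?x s * y s) - 2 * ((?u s * v s) / \<omega>\<^sup>2)) + ((y s)\<^sup>2 - (v s)\<^sup>2 / \<omega>\<^sup>2)"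
      unfolding split[OF s] by (simp add: power2_eq_square algebra_simps add_divide_distrib)
  qed
  also have "\<dots> = (LBINT s:{0..t}. (?x s)\<^sup>2 - (?u s)\<^sup>2 / \<omega>\<^sup>2) +
      (2 * (LBINT s:{0..t}. ?x s * y s) - 2 * ((LBINT s:{0..t}. ?u s * v s) / \<omega>\<^sup>2)) +
      ((LBINT s:{0..t}. (y s)\<^sup>2) - (LBINT s:{0..t}. (v s)\<^sup>2) / \<omega>\<^sup>2)"
    using x2 u2 xy uv y2 v2 \<omega> by simp
  also have "\<dots> = mode_value \<omega> t a b + 2 * ((LBINT s:{0..t}. ?x s * y s) -
      (LBINT s:{0..t}. ?u s * v s) / \<omega>\<^sup>2) +
      ((LBINT s:{0..t}. (y s)\<^sup>2) - (LBINT s:{0..t}. (v s)\<^sup>2) / \<omega>\<^sup>2)"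
    unfolding extremal_cost[OF t \<omega> sin] by (simp add: algebra_simps)
  also have "\<dots> \<le> mode_value \<omega> t a b"
    using short_time_cost_nonpos[OF t \<omega> short v v2] y2 cross by (simp add: y_def)
  finally show ?thesis .
qed

text \<open>The square of the position is discarded, and \<open>(b - a)\<^sup>2 \<le> 2 (a\<^sup>2 + b\<^sup>2)\<close>.\<close>

lemma constant_velocity_cost_ge:
  fixes a b t \<omega> :: real
  assumes t: "0 < t" and \<omega>: "0 < \<omega>"
  shows "- 2 * (1 / \<omega>\<^sup>2 * ((a\<^sup>2 + b\<^sup>2) / t)) \<le>
    (LBINT s:{0..t}. (a + s * ((b - a) / t))\<^sup>2 - ((b - a) / t)\<^sup>2 / \<omega>\<^sup>2)"
proof -
  have "(b - a)\<^sup>2 \<le> 2 * (a\<^sup>2 + b\<^sup>2)"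
    using zero_le_power2[of "a + b"] by (simp add: power2_eq_square algebra_simps)
  then have "- 2 * (1 / \<omega>\<^sup>2 * ((a\<^sup>2 + b\<^sup>2) / t)) \<le> - ((b - a) / t)\<^sup>2 / \<omega>\<^sup>2 * t"
    using t \<omega> by (simp add: divide_simps power2_eq_square)
  also have "\<dots> = (LBINT s:{0..t}. - ((b - a) / t)\<^sup>2 / \<omega>\<^sup>2)"
    using t by (subst set_integral_const_interval) simp_all
  also have "\<dots> \<le> (LBINT s:{0..t}. (a + s * ((b - a) / t))\<^sup>2 - ((b - a) / t)\<^sup>2 / \<omega>\<^sup>2)"
    using t \<omega> by (intro set_integral_mono borel_integrable_atLeastAtMost' continuous_intros) auto
  finally show ?thesis .
qed

section \<open>Decomposition of the cost into modes\<close>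

lemma set_integral_inner_left:
  fixes w :: "real \<Rightarrow> 'b::{real_inner, banach, second_countable_topology}"
  assumes "set_integrable lborel X w"
  shows "set_integrable lborel X (\<lambda>s. inner (w s) e)"
    and "inner (LBINT s:X. w s) e = (LBINT s:X. inner (w s) e)"
proof -
  have "integrable lborel (\<lambda>s. inner (indicator X s *\<^sub>R w s) e)"
    using assms unfolding set_integrable_def by (intro integrable_inner_left)
  then show "set_integrable lborel X (\<lambda>s. inner (w s) e)"
    by (simp add: set_integrable_def)
  have "inner (LBINT s. indicator X s *\<^sub>R w s) e = (LBINT s. inner (indicator X s *\<^sub>R w s) e)"
    using assms unfolding set_integrable_def by (intro integral_inner_left[symmetric])
  then show "inner (LBINT s:X. w s) e = (LBINT s:X. inner (w s) e)"
    by (simp add: set_lebesgue_integral_def)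
qed

lemma input_integrable:
  "w \<in> square_integrable_inputs t \<Longrightarrow> set_integrable lborel {0..t} w"
  by (auto simp: square_integrable_inputs_def intro: set_integrable_of_square)

lemma input_coordinate_square_integrable:
  fixes w :: "real \<Rightarrow> 'b::{real_inner, banach, second_countable_topology}"
  assumes w: "w \<in> square_integrable_inputs t"
  shows "set_integrable lborel {0..t} (\<lambda>s. (inner (w s) e)\<^sup>2)"
proof (rule set_integrable_bound)
  show "set_integrable lborel {0..t} (\<lambda>s. (norm e)\<^sup>2 * (norm (w s))\<^sup>2)"
    using w by (simp add: square_integrable_inputs_def)
  have [measurable]: "(\<lambda>s. indicator {0..t} s *\<^sub>R w s) \<in> borel_measurable borel"
    using w by (simp add: square_integrable_inputs_def set_borel_measurable_def)
  have "(\<lambda>s. (inner (indicator {0..t} s *\<^sub>R w s) e)\<^sup>2) \<in> borel_measurable lborel"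
    by measurable
  also have "(\<lambda>s. (inner (indicator {0..t} s *\<^sub>R w s) e)\<^sup>2) =
      (\<lambda>s. indicator {0..t} s *\<^sub>R (inner (w s) e)\<^sup>2)"
    by (auto split: split_indicator)
  finally show "set_borel_measurable lborel {0..t} (\<lambda>s. (inner (w s) e)\<^sup>2)"
    by (simp add: set_borel_measurable_def)
  have "(inner x e)\<^sup>2 \<le> (norm e)\<^sup>2 * (norm x)\<^sup>2" for x :: 'b
    using power_mono[OF Cauchy_Schwarz_ineq2[of x e] abs_ge_zero, of 2]
    by (simp add: power_mult_distrib mult.commute)
  then show "AE s in lborel. s \<in> {0..t} \<longrightarrow>
      norm ((inner (w s) e)\<^sup>2) \<le> norm ((norm e)\<^sup>2 * (norm (w s))\<^sup>2)"
    by simp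
qed

lemma trajectory_coordinate:
  assumes w: "w \<in> square_integrable_inputs t" and s: "s \<in> {0..t}"
  shows "inner (trajectory \<xi> w s) e = inner \<xi> e + (LBINT \<sigma>:{0..s}. inner (w \<sigma>) e)"
proof -
  have "set_integrable lborel {0..s} w"
    using s by (intro set_integrable_subset[OF input_integrable[OF w]]) auto
  then show ?thesis
    by (simp add: trajectory_def inner_add_left set_integral_inner_left(2))
qed

text \<open>The partial sums of the mode-wise integrands converge pointwise by Parseval's identity, and by
  Bessel's inequality they are dominated by a constant plus a multiple of \<open>\<parallel>w s\<parallel>\<^sup>2\<close>. This domination
  is where a uniform bound on \<open>1 / \<omega>\<^sub>n\<^sup>2\<close> enters; it also yields the measurability of the limit
  integrand.\<close>

lemma cost_sums_mode_costs:
  fixes e :: "nat \<Rightarrow> 'b::{real_inner, banach, second_countable_topology}"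
  assumes e: "total_orthonormal e"
    and kin: "\<And>w. (\<lambda>n. (inner w (e n))\<^sup>2 / (\<omega> n)\<^sup>2 / 2) sums kin w"
    and C: "\<And>n. 1 / (\<omega> n)\<^sup>2 \<le> C"
    and w: "w \<in> square_integrable_inputs t"
  shows "(\<lambda>n. (LBINT s:{0..t}. (inner \<xi> (e n) + (LBINT \<sigma>:{0..s}. inner (w \<sigma>) (e n)))\<^sup>2 -
      (inner (w s) (e n))\<^sup>2 / (\<omega> n)\<^sup>2) / 2) sums
    (LBINT s:{0..t}. potential (trajectory \<xi> w s) - kin (w s))"
proof -
  let ?x = "trajectory \<xi> w"
  define x where "x n s = inner \<xi> (e n) + (LBINT \<sigma>:{0..s}. inner (w \<sigma>) (e n))" for n s
  define c where "c n s = ((x n s)\<^sup>2 - (inner (w s) (e n))\<^sup>2 / (\<omega> n)\<^sup>2) / 2" for n s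
  define K where "K = norm \<xi> + (LBINT \<sigma>:{0..t}. norm (w \<sigma>))"
  have wI: "set_integrable lborel {0..t} w"
    by (rule input_integrable[OF w])
  have x: "x n s = inner (?x s) (e n)" if "s \<in> {0..t}" for n s
    using trajectory_coordinate[OF w that] by (simp add: x_def)
  have C0: "0 \<le> C"
    using C[of 0] by (rule order_trans[rotated]) simp
  have c: "set_integrable lborel {0..t} (c n)" for n
  proof -
    have wn: "set_integrable lborel {0..t} (\<lambda>s. inner (w s) (e n))"
      by (rule set_integral_inner_left(1)[OF wI])
    let ?W = "\<lambda>s. LBINT \<sigma>:{0..s}. inner (w \<sigma>) (e n)"
    have W: "set_integrable lborel {0..t} ?W"
      using primitive_mult_integrable[OF wn, of "\<lambda>_. 1"] by (simp add: borel_integrable_atLeastAtMost')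
    have W2: "set_integrable lborel {0..t} (\<lambda>s. (?W s)\<^sup>2)"
      using primitive_mult_integrable[OF wn W] by (simp add: power2_eq_square)
    have "c n = (\<lambda>s. ((inner \<xi> (e n))\<^sup>2 / 2 + inner \<xi> (e n) * ?W s + (1/2) * (?W s)\<^sup>2) -
        (1 / (\<omega> n)\<^sup>2 / 2) * (inner (w s) (e n))\<^sup>2)"
      by (auto simp: c_def x_def power2_eq_square field_simps)
    moreover have "set_integrable lborel {0..t} (\<lambda>_. (inner \<xi> (e n))\<^sup>2 / 2)"
      by (intro borel_integrable_atLeastAtMost' continuous_intros)
    ultimately show ?thesis
      by (simp only:) (intro set_integral_add(1) set_integral_diff(1) set_integrable_mult_right
          W W2 input_coordinate_square_integrable[OF w])
  qed
  have pointwise: "(\<lambda>n. c n s) sums (potential (?x s) - kin (w s))" if s: "s \<in> {0..t}" for s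
  proof -
    have "(\<lambda>n. (inner (?x s) (e n))\<^sup>2 / 2 - (inner (w s) (e n))\<^sup>2 / (\<omega> n)\<^sup>2 / 2) sums
        ((norm (?x s))\<^sup>2 / 2 - kin (w s))"
      by (intro sums_diff sums_divide parseval_norm e kin)
    then show ?thesis
      by (simp add: c_def x[OF s] potential_def diff_divide_distrib)
  qed
  have bound: "\<bar>\<Sum>n<N. c n s\<bar> \<le> (K\<^sup>2 + C * (norm (w s))\<^sup>2) / 2" if s: "s \<in> {0..t}" for N s
  proof -
    have "norm (?x s) \<le> norm \<xi> + norm (LBINT \<sigma>:{0..s}. w \<sigma>)"
      unfolding trajectory_def by (rule norm_triangle_ineq)
    then have "norm (?x s) \<le> K"
      unfolding K_def using norm_primitive_le[OF wI s] by linarith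
    then have xK: "(norm (?x s))\<^sup>2 \<le> K\<^sup>2"
      by (intro power_mono) auto
    have "\<bar>\<Sum>n<N. c n s\<bar> \<le> (\<Sum>n<N. ((x n s)\<^sup>2 + C * (inner (w s) (e n))\<^sup>2) / 2)"
    proof (rule order_trans[OF sum_abs], rule sum_mono)
      fix n
      have "(inner (w s) (e n))\<^sup>2 / (\<omega> n)\<^sup>2 \<le> C * (inner (w s) (e n))\<^sup>2"
        using mult_right_mono[OF C[of n] zero_le_power2[of "inner (w s) (e n)"]] by simp
      moreover have "0 \<le> (inner (w s) (e n))\<^sup>2 / (\<omega> n)\<^sup>2" "0 \<le> (x n s)\<^sup>2" by simp_all
      moreover have "\<bar>(p - q) / 2\<bar> \<le> (p + r) / 2" if "q \<le> r" "0 \<le> q" "0 \<le> p" for p q r :: real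
      proof -
        have "\<bar>p - q\<bar> \<le> p + r" using that by (simp add: abs_if)
        then show ?thesis by simp
      qed
      ultimately show "\<bar>c n s\<bar> \<le> ((x n s)\<^sup>2 + C * (inner (w s) (e n))\<^sup>2) / 2"
        unfolding c_def by blast
    qed
    also have "\<dots> = ((\<Sum>n<N. (inner (?x s) (e n))\<^sup>2) + C * (\<Sum>n<N. (inner (w s) (e n))\<^sup>2)) / 2"
      by (simp add: x[OF s] sum.distrib sum_distrib_left sum_divide_distrib[symmetric])
    also have "\<dots> \<le> ((norm (?x s))\<^sup>2 + C * (norm (w s))\<^sup>2) / 2"
      by (intro divide_right_mono add_mono mult_left_mono bessel_inequality e C0) auto
    finally show ?thesis
      using xK by simp
  qed
  \<comment> \<open>Dominated convergence on the whole line, with the integrands cut off outside \<open>[0, t]\<close>.\<close>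
  let ?s = "\<lambda>N s. indicator {0..t} s *\<^sub>R (\<Sum>n<N. c n s)"
  let ?f = "\<lambda>s. indicator {0..t} s *\<^sub>R (potential (?x s) - kin (w s))"
  have ind: "?s N s = (\<Sum>n<N. indicator {0..t} s *\<^sub>R c n s)" for N s
    by (rule scaleR_sum_right)
  have sM: "?s N \<in> borel_measurable lborel" for N
    unfolding ind using c by (intro borel_measurable_sum) (auto simp: set_integrable_def)
  have lim: "(\<lambda>N. ?s N s) \<longlonglongrightarrow> ?f s" for s
    using pointwise[of s] by (auto simp: sums_def split: split_indicator)
  have "(\<lambda>N. LBINT s. ?s N s) \<longlonglongrightarrow> (LBINT s. ?f s)"
  proof (rule integral_dominated_convergence)
    show "?s N \<in> borel_measurable lborel" for N by (rule sM)
    show "?f \<in> borel_measurable lborel"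
      by (rule borel_measurable_LIMSEQ_real[OF lim sM])
    have "set_integrable lborel {0..t} (\<lambda>s. K\<^sup>2 / 2 + (C / 2) * (norm (w s))\<^sup>2)"
    proof (rule set_integral_add(1))
      show "set_integrable lborel {0..t} (\<lambda>s. K\<^sup>2 / 2)"
        by (intro borel_integrable_atLeastAtMost' continuous_intros)
      show "set_integrable lborel {0..t} (\<lambda>s. (C / 2) * (norm (w s))\<^sup>2)"
        using w by (intro set_integrable_mult_right) (simp add: square_integrable_inputs_def)
    qed
    then show "integrable lborel (\<lambda>s. indicator {0..t} s *\<^sub>R ((K\<^sup>2 + C * (norm (w s))\<^sup>2) / 2))"
      by (simp add: set_integrable_def add_divide_distrib)
    show "AE s in lborel. norm (?s N s) \<le>
        indicator {0..t} s *\<^sub>R ((K\<^sup>2 + C * (norm (w s))\<^sup>2) / 2)" for N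
      using bound by (auto split: split_indicator)
    show "AE s in lborel. (\<lambda>N. ?s N s) \<longlonglongrightarrow> ?f s"
      using lim by simp
  qed
  moreover have "(LBINT s. ?s N s) = (\<Sum>n<N. LBINT s:{0..t}. c n s)" for N
    unfolding ind set_lebesgue_integral_def
    using c by (intro Bochner_Integration.integral_sum) (auto simp: set_integrable_def)
  ultimately have "(\<lambda>n. LBINT s:{0..t}. c n s) sums (LBINT s:{0..t}. potential (?x s) - kin (w s))"
    by (simp add: sums_def set_lebesgue_integral_def)
  moreover have "(LBINT s:{0..t}. c n s) =
      (LBINT s:{0..t}. (x n s)\<^sup>2 - (inner (w s) (e n))\<^sup>2 / (\<omega> n)\<^sup>2) / 2" for n
    unfolding c_def by (rule set_integral_divide_zero)
  ultimately show ?thesis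
    by (simp add: x_def)
qed

section \<open>The value of the control problem\<close>

text \<open>The angle lies strictly between \<open>0\<close> and \<open>2\<close>, hence below \<open>pi\<close>.\<close>

lemma short_time_angle:
  fixes \<omega> t :: real
  assumes "0 < \<omega>" "0 < t" "(\<omega> * t)\<^sup>2 \<le> 2"
  shows "0 < sin (\<omega> * t)"
proof (rule sin_gt_zero)
  have "(\<omega> * t)\<^sup>2 < 2\<^sup>2" using assms(3) by simp
  then have "\<omega> * t < 2" by (rule power_less_imp_less_base) simp
  then show "\<omega> * t < pi" using pi_ge_two by linarith
qed (use assms in simp)

text \<open>The velocity that is extremal in the modes below \<open>N\<close> and constant in the others. It is written as a
  correction of the straight line from \<open>\<xi>\<close> to \<open>\<zeta>\<close> in finitely many coordinates, which makes its
  continuity evident.\<close>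

definition truncated_extremal_input ::
    "(nat \<Rightarrow> 'b::real_inner) \<Rightarrow> (nat \<Rightarrow> real) \<Rightarrow> real \<Rightarrow> 'b \<Rightarrow> 'b \<Rightarrow> nat \<Rightarrow> real \<Rightarrow> 'b" where
  "truncated_extremal_input e \<omega> t \<xi> \<zeta> N s =
     (\<Sum>n<N. (extremal_velocity (\<omega> n) t (inner \<xi> (e n)) (inner \<zeta> (e n)) s -
        (inner \<zeta> (e n) - inner \<xi> (e n)) / t) *\<^sub>R e n) + (1 / t) *\<^sub>R (\<zeta> - \<xi>)"

lemma truncated_extremal_input_coordinate:
  assumes "total_orthonormal e"
  shows "inner (truncated_extremal_input e \<omega> t \<xi> \<zeta> N s) (e n) =
    (if n < N then extremal_velocity (\<omega> n) t (inner \<xi> (e n)) (inner \<zeta> (e n)) s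
     else (inner \<zeta> (e n) - inner \<xi> (e n)) / t)"
  unfolding truncated_extremal_input_def inner_add_left
    inner_sum_orthonormal[OF assms finite_lessThan]
  by (simp add: inner_diff_left)

lemma truncated_extremal_input_square_integrable:
  fixes e :: "nat \<Rightarrow> 'b::{real_inner, banach, second_countable_topology}"
  shows "truncated_extremal_input e \<omega> t \<xi> \<zeta> N \<in> square_integrable_inputs t"
proof -
  have ev: "continuous_on A (extremal_velocity \<omega>' t a b)" for A \<omega>' a b
    by (intro continuous_at_imp_continuous_on ballI isCont_extremal_velocity)
  have "continuous_on {0..t} (truncated_extremal_input e \<omega> t \<xi> \<zeta> N)"
    unfolding truncated_extremal_input_def[abs_def] by (intro continuous_intros ev)
  then show ?thesis
    unfolding square_integrable_inputs_def set_borel_measurable_def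
    by (auto intro!: borel_integrable_atLeastAtMost' continuous_intros
        borel_measurable_continuous_on_indicator simp del: scaleR_conv_of_real)
qed

lemma truncated_extremal_trajectory_coordinate:
  fixes e :: "nat \<Rightarrow> 'b::{real_inner, banach, second_countable_topology}"
  assumes e: "total_orthonormal e" and sin: "sin (\<omega> n * t) \<noteq> 0" and s: "0 \<le> s" 
  shows "inner \<xi> (e n) + (LBINT \<sigma>:{0..s}. inner (truncated_extremal_input e \<omega> t \<xi> \<zeta> N \<sigma>) (e n)) =
    (if n < N then extremal (\<omega> n) t (inner \<xi> (e n)) (inner \<zeta> (e n)) s
     else inner \<xi> (e n) + s * ((inner \<zeta> (e n) - inner \<xi> (e n)) / t))"
  unfolding truncated_extremal_input_coordinate[OF e]
  using extremal_primitive[where s=s, OF s sin] set_integral_const_interval[OF s] by simp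

text \<open>In every coordinate the trajectory ends at the coordinate of \<open>\<zeta>\<close>, whichever of the two kinds the
  mode is.\<close>

lemma truncated_extremal_trajectory_end:
  fixes e :: "nat \<Rightarrow> 'b::{real_inner, banach, second_countable_topology}"
  assumes e: "total_orthonormal e" and sin: "\<And>n. sin (\<omega> n * t) \<noteq> 0" and t: "0 < t"
  shows "trajectory \<xi> (truncated_extremal_input e \<omega> t \<xi> \<zeta> N) t = \<zeta>"
proof (rule total_orthonormal_eqI[OF e])
  fix n
  show "inner (trajectory \<xi> (truncated_extremal_input e \<omega> t \<xi> \<zeta> N) t) (e n) = inner \<zeta> (e n)"
    using t sin[of n]
    by (simp add: trajectory_coordinate[OF truncated_extremal_input_square_integrable]
        truncated_extremal_trajectory_coordinate[OF e] extremal_def)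
qed

text \<open>Mode-wise optimality gives the upper bound, and the truncated extremal inputs give the lower one:
  in a mode \<open>n \<ge> N\<close> the cost of such an input is at least \<open>- r n\<close>, with \<open>r\<close> summable, so the total
  cost is at least \<open>\<Sum>n<N. m n + r n\<close> minus the whole sum of \<open>r\<close>, and this tends to the sum of \<open>m\<close>.\<close>

lemma G_value_eq_sum_of_mode_values:
  fixes e :: "nat \<Rightarrow> 'b::{real_inner, banach, second_countable_topology}"
  assumes e: "total_orthonormal e" and t: "0 < t"
    and kin: "\<And>w. (\<lambda>n. (inner w (e n))\<^sup>2 / (\<omega> n)\<^sup>2 / 2) sums kinetic \<iota> \<mu> w"
    and C: "\<And>n. 1 / (\<omega> n)\<^sup>2 \<le> C"
    and pos: "\<And>n. 0 < \<omega> n" and short: "\<And>n. (\<omega> n * t)\<^sup>2 \<le> 2"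
    and G: "(\<lambda>n. mode_value (\<omega> n) t (inner \<xi> (e n)) (inner \<zeta> (e n)) / 2) sums G"
  shows "G_value \<iota> \<mu> t \<xi> \<zeta> = ereal G"
proof (rule antisym)
  have sin: "sin (\<omega> n * t) \<noteq> 0" for n
    using short_time_angle[OF pos t short, of n] by simp
  note sums = cost_sums_mode_costs[OF e kin C]
  show "G_value \<iota> \<mu> t \<xi> \<zeta> \<le> ereal G"
    unfolding G_value_def
  proof (rule SUP_least)
    fix w assume "w \<in> {w \<in> square_integrable_inputs t. trajectory \<xi> w 0 = \<xi> \<and> trajectory \<xi> w t = \<zeta>}"
    then have w: "w \<in> square_integrable_inputs t" and ends: "trajectory \<xi> w t = \<zeta>"
      by auto
    have "(LBINT s:{0..t}. potential (trajectory \<xi> w s) - kinetic \<iota> \<mu> (w s)) \<le> G"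
    proof (rule sums_le[OF _ sums[OF w] G])
      fix n
      have "(LBINT s:{0..t}. (inner \<xi> (e n) + (LBINT \<sigma>:{0..s}. inner (w \<sigma>) (e n)))\<^sup>2 -
          (inner (w s) (e n))\<^sup>2 / (\<omega> n)\<^sup>2) \<le> mode_value (\<omega> n) t (inner \<xi> (e n)) (inner \<zeta> (e n))"
      proof (rule mode_cost_le[OF _ pos sin short])
        show "set_integrable lborel {0..t} (\<lambda>s. inner (w s) (e n))"
          by (rule set_integral_inner_left(1)[OF input_integrable[OF w]])
        show "set_integrable lborel {0..t} (\<lambda>s. (inner (w s) (e n))\<^sup>2)"
          by (rule input_coordinate_square_integrable[OF w])
        show "inner \<xi> (e n) + (LBINT \<sigma>:{0..t}. inner (w \<sigma>) (e n)) = inner \<zeta> (e n)"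
          using trajectory_coordinate[OF w, of t \<xi> "e n"] ends t by simp
      qed (use t in simp)
      then show "(LBINT s:{0..t}. (inner \<xi> (e n) + (LBINT \<sigma>:{0..s}. inner (w \<sigma>) (e n)))\<^sup>2 -
          (inner (w s) (e n))\<^sup>2 / (\<omega> n)\<^sup>2) / 2 \<le>
          mode_value (\<omega> n) t (inner \<xi> (e n)) (inner \<zeta> (e n)) / 2"
        by (rule divide_right_mono) simp
    qed
    then show "ereal (LBINT s:{0..t}. potential (trajectory \<xi> w s) - kinetic \<iota> \<mu> (w s)) \<le> ereal G"
      by simp
  qed
  define m where "m n = mode_value (\<omega> n) t (inner \<xi> (e n)) (inner \<zeta> (e n)) / 2" for n
  define r where "r n = C * (((inner \<xi> (e n))\<^sup>2 + (inner \<zeta> (e n))\<^sup>2) / t)" for n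
  have "summable r"
    unfolding r_def by (intro summable_mult summable_divide summable_add summable_coefficients_squared e)
  then obtain R where R: "r sums R"
    by (auto simp: summable_def)
  have "ereal ((\<Sum>n<N. m n + r n) - R) \<le> G_value \<iota> \<mu> t \<xi> \<zeta>" for N
  proof -
    define w where "w = truncated_extremal_input e \<omega> t \<xi> \<zeta> N"
    let ?J = "LBINT s:{0..t}. potential (trajectory \<xi> w s) - kinetic \<iota> \<mu> (w s)"
    have w: "w \<in> square_integrable_inputs t"
      unfolding w_def by (rule truncated_extremal_input_square_integrable)
    have "trajectory \<xi> w t = \<zeta>"
      unfolding w_def by (rule truncated_extremal_trajectory_end[OF e sin t])
    moreover have "trajectory \<xi> w 0 = \<xi>"
      using set_integral_singleton[of 0 w] by (simp add: trajectory_def)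
    ultimately have le_sup: "ereal ?J \<le> G_value \<iota> \<mu> t \<xi> \<zeta>"
      unfolding G_value_def using w by (intro SUP_upper) auto
    \<comment> \<open>The minorant is \<open>m n\<close> for \<open>n < N\<close> and \<open>- r n\<close> otherwise, written so that it is visibly summable.\<close>
    have g: "(\<lambda>n. (if n \<in> {..<N} then m n + r n else 0) - r n) sums ((\<Sum>n<N. m n + r n) - R)"
      by (intro sums_diff sums_If_finite_set R) simp
    have "(\<Sum>n<N. m n + r n) - R \<le> ?J"
    proof (rule sums_le[OF _ g sums[OF w]])
      fix n
      let ?a = "inner \<xi> (e n)" and ?b = "inner \<zeta> (e n)"
      have "(LBINT s:{0..t}. (?a + (LBINT \<sigma>:{0..s}. inner (w \<sigma>) (e n)))\<^sup>2 -
          (inner (w s) (e n))\<^sup>2 / (\<omega> n)\<^sup>2) =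
        (LBINT s:{0..t}. if n < N
          then (extremal (\<omega> n) t ?a ?b s)\<^sup>2 - (extremal_velocity (\<omega> n) t ?a ?b s)\<^sup>2 / (\<omega> n)\<^sup>2
          else (?a + s * ((?b - ?a) / t))\<^sup>2 - ((?b - ?a) / t)\<^sup>2 / (\<omega> n)\<^sup>2)" (is "?c = _")
      proof (rule set_lebesgue_integral_cong, simp, intro allI impI)
        fix s assume "s \<in> {0..t}"
        then have s: "0 \<le> s" by simp
        show "(?a + (LBINT \<sigma>:{0..s}. inner (w \<sigma>) (e n)))\<^sup>2 - (inner (w s) (e n))\<^sup>2 / (\<omega> n)\<^sup>2 =
          (if n < N
            then (extremal (\<omega> n) t ?a ?b s)\<^sup>2 - (extremal_velocity (\<omega> n) t ?a ?b s)\<^sup>2 / (\<omega> n)\<^sup>2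
            else (?a + s * ((?b - ?a) / t))\<^sup>2 - ((?b - ?a) / t)\<^sup>2 / (\<omega> n)\<^sup>2)"
          unfolding w_def truncated_extremal_trajectory_coordinate[OF e sin s]
          unfolding truncated_extremal_input_coordinate[OF e] by simp
      qed
      then have c: "?c = (if n < N then mode_value (\<omega> n) t ?a ?b else
          (LBINT s:{0..t}. (?a + s * ((?b - ?a) / t))\<^sup>2 - ((?b - ?a) / t)\<^sup>2 / (\<omega> n)\<^sup>2))"
        using extremal_cost[OF less_imp_le[OF t] pos sin] by simp
      have tail: "- r n \<le>
          (LBINT s:{0..t}. (?a + s * ((?b - ?a) / t))\<^sup>2 - ((?b - ?a) / t)\<^sup>2 / (\<omega> n)\<^sup>2) / 2"
      proof -
        have "(1 / (\<omega> n)\<^sup>2) * ((?a\<^sup>2 + ?b\<^sup>2) / t) \<le> C * ((?a\<^sup>2 + ?b\<^sup>2) / t)"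
          using t by (intro mult_right_mono C) simp
        moreover have "- 2 * (1 / (\<omega> n)\<^sup>2 * ((?a\<^sup>2 + ?b\<^sup>2) / t)) \<le>
            (LBINT s:{0..t}. (?a + s * ((?b - ?a) / t))\<^sup>2 - ((?b - ?a) / t)\<^sup>2 / (\<omega> n)\<^sup>2)"
          by (rule constant_velocity_cost_ge[OF t pos])
        moreover have "- v \<le> y / 2" if "u \<le> v" "- 2 * u \<le> y" for u v y :: real
          using that by linarith
        ultimately show ?thesis
          unfolding r_def by blast
      qed
      show "(if n \<in> {..<N} then m n + r n else 0) - r n \<le> ?c / 2"
        unfolding c using tail by (simp add: m_def)
    qed
    then show ?thesis
      using le_sup by (simp add: order_trans[rotated])
  qed
  moreover have "(\<lambda>N. (\<Sum>n<N. m n + r n) - R) \<longlonglongrightarrow> G"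
    using tendsto_diff[OF sums_add[OF G R, unfolded sums_def] tendsto_const[of R]]
    by (simp add: m_def)
  ultimately show "ereal G \<le> G_value \<iota> \<mu> t \<xi> \<zeta>"
    by (intro LIMSEQ_le_const2[OF tendsto_ereal]) auto
qed

section \<open>The eigenvalues and the quadratic form of the value\<close>

lemma omega_short_time:
  assumes "0 < l" "0 < \<mu>" "0 < t" "t < tbar \<mu>"
  shows "(omega \<mu> l * t)\<^sup>2 \<le> 2"
proof -
  have "t\<^sup>2 \<le> (\<mu> * sqrt 2)\<^sup>2"
    using assms by (intro power_mono) (auto simp: tbar_def)
  also have "\<dots> = 2 * \<mu>\<^sup>2"
    by (simp add: power_mult_distrib)
  also have "\<dots> \<le> 2 * (1 / (omega \<mu> l)\<^sup>2)"
    using assms(1) by (simp add: inverse_omega_squared)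
  finally show ?thesis
    using omega_pos[OF assms(1), of \<mu>] by (simp add: field_simps)
qed

text \<open>The sequence of \<open>\<omega>\<^sub>n\<close> tends to \<open>1 / \<mu>\<close>, where the sine does not vanish since \<open>0 < t / \<mu> < sqrt 2\<close>, so
  the eigenvalues of \<open>Q\<close> converge; those of \<open>P\<close> are these times \<open>- cos (\<omega>\<^sub>n t)\<close>.\<close>

lemma eigenvalues_bounded:
  assumes eig: "\<And>n. 0 < eig n" and lim: "filterlim eig at_top sequentially"
    and \<mu>: "0 < \<mu>" and t: "0 < t" "t < tbar \<mu>"
  obtains K where "\<And>n. \<bar>p_eigenvalue \<mu> t (eig n)\<bar> \<le> K" "\<And>n. \<bar>q_eigenvalue \<mu> t (eig n)\<bar> \<le> K"
proof -
  have "((\<lambda>l. 1 / sqrt (1 / l + \<mu>\<^sup>2)) \<longlongrightarrow> 1 / sqrt (0 + \<mu>\<^sup>2)) at_top"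
    using \<mu> by (intro tendsto_intros tendsto_divide_0[OF tendsto_const] filterlim_at_top_imp_at_infinity
        filterlim_ident) auto
  then have "(\<lambda>n. 1 / sqrt (1 / eig n + \<mu>\<^sup>2)) \<longlonglongrightarrow> 1 / \<mu>"
    using filterlim_compose[OF _ lim] \<mu> by fastforce
  moreover have "omega \<mu> (eig n) = 1 / sqrt (1 / eig n + \<mu>\<^sup>2)" for n
    using omega_pos[OF eig, of \<mu> n] inverse_omega_squared[OF eig[of n], of \<mu>, symmetric]
    by (simp add: real_sqrt_divide)
  ultimately have om: "(\<lambda>n. omega \<mu> (eig n)) \<longlonglongrightarrow> 1 / \<mu>"
    by simp
  have "0 < sin (1 / \<mu> * t)"
  proof (rule short_time_angle)
    have "t\<^sup>2 \<le> (\<mu> * sqrt 2)\<^sup>2"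
      using t by (intro power_mono) (auto simp: tbar_def)
    then show "(1 / \<mu> * t)\<^sup>2 \<le> 2"
      using \<mu> by (simp add: field_simps)
  qed (use \<mu> t in auto)
  then have "(\<lambda>n. q_eigenvalue \<mu> t (eig n)) \<longlonglongrightarrow> 1 / (1 / \<mu> * sin (1 / \<mu> * t))"
    unfolding q_eigenvalue_def using \<mu> by (intro tendsto_intros om) auto
  then obtain K where K: "\<And>n. \<bar>q_eigenvalue \<mu> t (eig n)\<bar> \<le> K"
    using convergent_imp_Bseq[OF convergentI] by (fastforce simp: Bseq_def)
  have "\<bar>p_eigenvalue \<mu> t (eig n)\<bar> \<le> \<bar>q_eigenvalue \<mu> t (eig n)\<bar>" for n
  proof -
    let ?x = "omega \<mu> (eig n) * t"
    have "p_eigenvalue \<mu> t (eig n) = - (cos ?x * q_eigenvalue \<mu> t (eig n))"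
      by (simp add: p_eigenvalue_def q_eigenvalue_def tan_def)
    then show ?thesis
      using mult_right_mono[OF abs_cos_le_one[of ?x] abs_ge_zero] by (simp add: abs_mult)
  qed
  then show ?thesis
    using K by (intro that[of K]) (meson order_trans)+
qed

theorem theorem3p3:
  fixes D D1 :: "'a::{real_inner, banach} set"
    and \<Lambda> S :: "'a \<Rightarrow> 'a"
    and \<phi> :: "nat \<Rightarrow> 'a"
    and eig :: "nat \<Rightarrow> real"
    and \<iota> :: "'b::{real_inner, banach, second_countable_topology} \<Rightarrow> 'a"
    and \<phi>t :: "nat \<Rightarrow> 'b"
    and \<mu> t :: real
  assumes "self_adjoint_on D \<Lambda>"
    and "positive_on D \<Lambda>"
    and "unbounded_on D \<Lambda>"
    and "has_compact_inverse_on D \<Lambda>"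
    and "positive_square_root_on D \<Lambda> D1 S"
    and "represents_domain \<iota> D1 S"
    and "orthonormal_basis \<phi>"
    and "\<And>n. \<phi> n \<in> D"
    and "\<And>n. \<Lambda> (\<phi> n) = eig n *\<^sub>R \<phi> n"
    and "\<And>n. 0 < eig n"
    and "incseq eig"
    and "filterlim eig at_top sequentially"
    and "\<And>n. \<iota> (\<phi>t n) = \<phi> n /\<^sub>R sqrt (eig n)"
    and "0 < \<mu>"
    and "0 < t"
    and "t < tbar \<mu>"
  shows "\<exists>P Q :: 'b \<Rightarrow>\<^sub>L 'b.
    self_adjoint_on UNIV (blinfun_apply P) \<and> self_adjoint_on UNIV (blinfun_apply Q) \<and>
    (\<forall>\<xi> \<zeta>. G_value \<iota> \<mu> t \<xi> \<zeta> =
        ereal (1 / 2 * inner (\<xi>, \<zeta>) (block_operator P Q (\<xi>, \<zeta>)))) \<and>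
    (\<forall>\<xi>. (\<lambda>n. (p_eigenvalue \<mu> t (eig n) * inner \<xi> (\<phi>t n)) *\<^sub>R \<phi>t n) sums blinfun_apply P \<xi>) \<and>
    (\<forall>\<xi>. (\<lambda>n. (q_eigenvalue \<mu> t (eig n) * inner \<xi> (\<phi>t n)) *\<^sub>R \<phi>t n) sums blinfun_apply Q \<xi>)"
proof -
  note basis = orthonormal_basis_imp_total[OF assms(7)]
  note e = normalized_eigenvectors_total[OF assms(5,6) basis assms(8-10,13)]
  let ?p = "\<lambda>n. p_eigenvalue \<mu> t (eig n)" and ?q = "\<lambda>n. q_eigenvalue \<mu> t (eig n)"
  obtain K where K: "\<And>n. \<bar>?p n\<bar> \<le> K" "\<And>n. \<bar>?q n\<bar> \<le> K"
    by (rule eigenvalues_bounded[OF assms(10,12,14-16)]) (rule that)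
  obtain P :: "'b \<Rightarrow>\<^sub>L 'b" where P: "self_adjoint_on UNIV (blinfun_apply P)"
    "\<And>x. (\<lambda>n. (?p n * inner x (\<phi>t n)) *\<^sub>R \<phi>t n) sums P x"
    "\<And>x y. (\<lambda>n. ?p n * (inner x (\<phi>t n) * inner y (\<phi>t n))) sums inner x (P y)"
    by (rule diagonal_operator_exists[OF e K(1)]) (rule that)
  obtain Q :: "'b \<Rightarrow>\<^sub>L 'b" where Q: "self_adjoint_on UNIV (blinfun_apply Q)"
    "\<And>x. (\<lambda>n. (?q n * inner x (\<phi>t n)) *\<^sub>R \<phi>t n) sums Q x"
    "\<And>x y. (\<lambda>n. ?q n * (inner x (\<phi>t n) * inner y (\<phi>t n))) sums inner x (Q y)"
    by (rule diagonal_operator_exists[OF e K(2)]) (rule that)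
  have "G_value \<iota> \<mu> t \<xi> \<zeta> = ereal (1 / 2 * inner (\<xi>, \<zeta>) (block_operator P Q (\<xi>, \<zeta>)))" for \<xi> \<zeta>
  proof (rule G_value_eq_sum_of_mode_values[OF e \<open>0 < t\<close>])
    show "(\<lambda>n. (inner w (\<phi>t n))\<^sup>2 / (omega \<mu> (eig n))\<^sup>2 / 2) sums kinetic \<iota> \<mu> w" for w
      by (rule kinetic_sums[OF assms(5,6) basis assms(8-10,13)])
    show "1 / (omega \<mu> (eig n))\<^sup>2 \<le> 1 / eig 0 + \<mu>\<^sup>2" for n
      using assms(10)[of 0] incseqD[OF \<open>incseq eig\<close>, of 0 n]
      by (simp add: inverse_omega_squared assms(10) frac_le)
    show "0 < omega \<mu> (eig n)" for n
      by (rule omega_pos[OF assms(10)])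
    show "(omega \<mu> (eig n) * t)\<^sup>2 \<le> 2" for n
      by (rule omega_short_time[OF assms(10,14-16)])
    let ?m = "\<lambda>n. ?p n * (inner \<xi> (\<phi>t n) * inner \<xi> (\<phi>t n)) + ?q n * (inner \<xi> (\<phi>t n) * inner \<zeta> (\<phi>t n)) +
      (?q n * (inner \<zeta> (\<phi>t n) * inner \<xi> (\<phi>t n)) + ?p n * (inner \<zeta> (\<phi>t n) * inner \<zeta> (\<phi>t n)))"
    have "(\<lambda>n. ?m n / 2) sums ((inner \<xi> (P \<xi>) + inner \<xi> (Q \<zeta>) + (inner \<zeta> (Q \<xi>) + inner \<zeta> (P \<zeta>))) / 2)"
      by (intro sums_divide sums_add P(3) Q(3))
    moreover have "?m n = mode_value (omega \<mu> (eig n)) t (inner \<xi> (\<phi>t n)) (inner \<zeta> (\<phi>t n))" for n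
      unfolding mode_value_def p_eigenvalue_def[symmetric] q_eigenvalue_def[symmetric]
      by (simp add: power2_eq_square algebra_simps)
    ultimately show "(\<lambda>n. mode_value (omega \<mu> (eig n)) t (inner \<xi> (\<phi>t n)) (inner \<zeta> (\<phi>t n)) / 2) sums
        (1 / 2 * inner (\<xi>, \<zeta>) (block_operator P Q (\<xi>, \<zeta>)))"
      by (simp add: block_operator_def inner_add_right)
  qed
  then show ?thesis
    using P(1,2) Q(1,2) by blast
qed

end
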